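(* Let $\Omega$ be a bounded Lipschitz domain, let $\Sigma_h\subset\mathbf{H}(\mathrm{div};\Omega)$ and $U_h\subset H^1_0(\Omega)$ be finite dimensional (conforming finite element) subspaces with chosen bases, and let $\mathsf{A}$, $\mathsf{B}$, $\mathsf{C}$ be the matrices associated, respectively, with the bilinear forms $(\boldsymbol{\sigma},\boldsymbol{\tau})+(\mathrm{div}\,\boldsymbol{\sigma},\mathrm{div}\,\boldsymbol{\tau})$ on $\Sigma_h\times\Sigma_h$, $-(\boldsymbol{\sigma},\nabla v)$ on $\Sigma_h\times U_h$, and $(\nabla u,\nabla v)$ on $U_h\times U_h$. Then the generalized eigenvalue problem $$\begin{pmatrix}\mathsf{A}&\mathsf{B}^\top\\ \mathsf{B}&\mathsf{C}\end{pmatrix}\begin{pmatrix}\mathsf{x}\\ \mathsf{y}\end{pmatrix}=\lambda_h\begin{pmatrix}0&0\\ -\mathsf{B}&0\end{pmatrix}\begin{pmatrix}\mathsf{x}\\ \mathsf{y}\end{pmatrix}$$ has three families of eigenvalues: (1) $\lambda_h=\infty$ with multiplicity $\dim U_h$; (2) $\lambda_h=\infty$ with multiplicity $\dim\ker(\mathsf{B})$; (3) a number of positive eigenvalues $\lambda_h$ (counted with their multiplicities) equal to $\mathrm{rank}(\mathsf{B})$.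
   Context: $(\cdot,\cdot)$ is the $L^2(\Omega)$ (or $L^2(\Omega)^d$) inner product; $\mathbf{H}(\mathrm{div};\Omega)=\{\boldsymbol{\tau}\in L^2(\Omega)^d:\mathrm{div}\,\boldsymbol{\tau}\in L^2(\Omega)\}$. The matrix $\mathsf{B}$ has $\dim U_h$ rows (test functions $v\in U_h$) and $\dim\Sigma_h$ columns; it acts on coefficient vectors $\mathsf{x}$ of elements of $\Sigma_h$. Convention for a generalized eigenvalue problem $\mathcal{A}z=\lambda\mathcal{B}z$ with $\mathcal{A}$ invertible and $\mathcal{B}$ singular: $\lambda=\infty$ is an eigenvalue with eigenspace $\ker\mathcal{B}$; equivalently one considers $\mathcal{B}z=\mu\mathcal{A}z$, where $\mu=0$ corresponds to $\lambda=\infty$ and $\mu\ne0$ to $\lambda=1/\mu$. The total multiplicity is $\dim\Sigma_h+\dim U_h$, and families (1) and (2) together make up the eigenvalue $\infty$. *)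

theory Defs
  imports
    "HOL-Analysis.Analysis"
    "HOL-Library.Multiset"
    "Jordan_Normal_Form.Matrix_Kernel"
    "Jordan_Normal_Form.DL_Rank"
begin

text \<open>Near each boundary point the set is, in the orthogonal splitting of the space into the line
  spanned by a unit vector \<open>e\<close> and its orthogonal complement, the strict hypograph of a Lipschitz
  function on the complement.\<close>

definition bounded_lipschitz_domain :: "'a::euclidean_space set \<Rightarrow> bool" where
  "bounded_lipschitz_domain \<Omega> \<longleftrightarrow>
     open \<Omega> \<and> connected \<Omega> \<and> \<Omega> \<noteq> {} \<and> bounded \<Omega> \<and>
     (\<forall>p\<in>frontier \<Omega>. \<exists>e W L (g :: 'a \<Rightarrow> real).
        norm e = 1 \<and> open W \<and> p \<in> W \<and> L-lipschitz_on {y. inner y e = 0} g \<and>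
        \<Omega> \<inter> W = {x \<in> W. inner x e < g (x - inner x e *\<^sub>R e)})"

text \<open>Elements of \<open>L\<^sup>2\<close> and of the Sobolev spaces are represented by functions on the whole space, of
  which only the values on \<open>\<Omega>\<close>, up to null sets, matter.\<close>

definition L2 :: "'a::euclidean_space set \<Rightarrow> ('a \<Rightarrow> 'b::euclidean_space) set" where
  "L2 \<Omega> = {f. f \<in> borel_measurable (lebesgue_on \<Omega>) \<and>
              integrable (lebesgue_on \<Omega>) (\<lambda>x. (norm (f x))\<^sup>2)}"

definition l2_inner ::
    "'a::euclidean_space set \<Rightarrow> ('a \<Rightarrow> 'b::euclidean_space) \<Rightarrow> ('a \<Rightarrow> 'b) \<Rightarrow> real" where
  "l2_inner \<Omega> f g = (LINT x|lebesgue_on \<Omega>. inner (f x) (g x))"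

definition l2_norm :: "'a::euclidean_space set \<Rightarrow> ('a \<Rightarrow> 'b::euclidean_space) \<Rightarrow> real" where
  "l2_norm \<Omega> f = sqrt (l2_inner \<Omega> f f)"

primrec C_k :: "nat \<Rightarrow> ('a::euclidean_space \<Rightarrow> real) \<Rightarrow> bool" where
  "C_k 0 f \<longleftrightarrow> continuous_on UNIV f"
| "C_k (Suc k) f \<longleftrightarrow> (\<forall>x. f differentiable (at x)) \<and>
     (\<forall>b\<in>Basis. C_k k (\<lambda>x. frechet_derivative f (at x) b))"

definition test_functions :: "'a::euclidean_space set \<Rightarrow> ('a \<Rightarrow> real) set" where
  "test_functions \<Omega> = {\<phi>. (\<forall>k. C_k k \<phi>) \<and>
     compact (closure {x. \<phi> x \<noteq> 0}) \<and> closure {x. \<phi> x \<noteq> 0} \<subseteq> \<Omega>}"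

definition grad :: "('a::euclidean_space \<Rightarrow> real) \<Rightarrow> 'a \<Rightarrow> 'a" where
  "grad \<phi> x = (\<Sum>b\<in>Basis. frechet_derivative \<phi> (at x) b *\<^sub>R b)"

definition has_weak_grad ::
    "'a::euclidean_space set \<Rightarrow> ('a \<Rightarrow> real) \<Rightarrow> ('a \<Rightarrow> 'a) \<Rightarrow> bool" where
  "has_weak_grad \<Omega> v g \<longleftrightarrow> g \<in> L2 \<Omega> \<and>
     (\<forall>\<phi>\<in>test_functions \<Omega>. (LINT x|lebesgue_on \<Omega>. v x *\<^sub>R grad \<phi> x)
        = - (LINT x|lebesgue_on \<Omega>. \<phi> x *\<^sub>R g x))"

definition has_weak_div ::
    "'a::euclidean_space set \<Rightarrow> ('a \<Rightarrow> 'a) \<Rightarrow> ('a \<Rightarrow> real) \<Rightarrow> bool" where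
  "has_weak_div \<Omega> \<tau> g \<longleftrightarrow> g \<in> L2 \<Omega> \<and>
     (\<forall>\<phi>\<in>test_functions \<Omega>. l2_inner \<Omega> \<tau> (grad \<phi>) = - l2_inner \<Omega> g \<phi>)"

text \<open>Weak derivatives are unique only up to null sets, hence the choice.\<close>

definition weak_grad :: "'a::euclidean_space set \<Rightarrow> ('a \<Rightarrow> real) \<Rightarrow> 'a \<Rightarrow> 'a" where
  "weak_grad \<Omega> v = (SOME g. has_weak_grad \<Omega> v g)"

definition weak_div :: "'a::euclidean_space set \<Rightarrow> ('a \<Rightarrow> 'a) \<Rightarrow> 'a \<Rightarrow> real" where
  "weak_div \<Omega> \<tau> = (SOME g. has_weak_div \<Omega> \<tau> g)"

definition Hdiv :: "'a::euclidean_space set \<Rightarrow> ('a \<Rightarrow> 'a) set" where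
  "Hdiv \<Omega> = {\<tau> \<in> L2 \<Omega>. \<exists>g. has_weak_div \<Omega> \<tau> g}"

definition H1 :: "'a::euclidean_space set \<Rightarrow> ('a \<Rightarrow> real) set" where
  "H1 \<Omega> = {v \<in> L2 \<Omega>. \<exists>g. has_weak_grad \<Omega> v g}"

definition H10 :: "'a::euclidean_space set \<Rightarrow> ('a \<Rightarrow> real) set" where
  "H10 \<Omega> = {v \<in> H1 \<Omega>. \<exists>\<phi> :: nat \<Rightarrow> 'a \<Rightarrow> real. (\<forall>k. \<phi> k \<in> test_functions \<Omega>) \<and>
     (\<lambda>k. l2_norm \<Omega> (\<lambda>x. \<phi> k x - v x)) \<longlonglongrightarrow> 0 \<and>
     (\<lambda>k. l2_norm \<Omega> (\<lambda>x. grad (\<phi> k) x - weak_grad \<Omega> v x)) \<longlonglongrightarrow> 0}"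

definition function_subspace :: "('a \<Rightarrow> 'b::real_vector) set \<Rightarrow> bool" where
  "function_subspace V \<longleftrightarrow> (\<lambda>x. 0) \<in> V \<and>
     (\<forall>f\<in>V. \<forall>g\<in>V. (\<lambda>x. f x + g x) \<in> V) \<and> (\<forall>c. \<forall>f\<in>V. (\<lambda>x. c *\<^sub>R f x) \<in> V)"

text \<open>The functions \<open>b 0, \<dots>, b (n - 1)\<close> are a basis of \<open>V\<close> modulo equality almost everywhere on \<open>\<Omega>\<close>;
  in particular \<open>n\<close> is the dimension of \<open>V\<close> as a subspace of \<open>L\<^sup>2(\<Omega>)\<close>.\<close>

definition ae_basis ::
    "'a::euclidean_space set \<Rightarrow> ('a \<Rightarrow> 'b::euclidean_space) set \<Rightarrow> nat \<Rightarrow> (nat \<Rightarrow> 'a \<Rightarrow> 'b) \<Rightarrow> bool" where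
  "ae_basis \<Omega> V n b \<longleftrightarrow> (\<forall>i<n. b i \<in> V) \<and>
     (\<forall>c. (AE x in lebesgue_on \<Omega>. (\<Sum>i<n. c i *\<^sub>R b i x) = 0) \<longrightarrow> (\<forall>i<n. c i = 0)) \<and>
     (\<forall>f\<in>V. \<exists>c. AE x in lebesgue_on \<Omega>. f x = (\<Sum>i<n. c i *\<^sub>R b i x))"

text \<open>In all three matrices rows are indexed by test functions and columns by trial functions.\<close>

definition mat_A :: "'a::euclidean_space set \<Rightarrow> nat \<Rightarrow> (nat \<Rightarrow> 'a \<Rightarrow> 'a) \<Rightarrow> real mat" where
  "mat_A \<Omega> n s = mat n n (\<lambda>(i, j).
     l2_inner \<Omega> (s j) (s i) + l2_inner \<Omega> (weak_div \<Omega> (s j)) (weak_div \<Omega> (s i)))"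

definition mat_B ::
    "'a::euclidean_space set \<Rightarrow> nat \<Rightarrow> nat \<Rightarrow> (nat \<Rightarrow> 'a \<Rightarrow> 'a) \<Rightarrow> (nat \<Rightarrow> 'a \<Rightarrow> real) \<Rightarrow> real mat" where
  "mat_B \<Omega> n m s u = mat m n (\<lambda>(i, j). - l2_inner \<Omega> (s j) (weak_grad \<Omega> (u i)))"

definition mat_C :: "'a::euclidean_space set \<Rightarrow> nat \<Rightarrow> (nat \<Rightarrow> 'a \<Rightarrow> real) \<Rightarrow> real mat" where
  "mat_C \<Omega> m u = mat m m (\<lambda>(i, j). l2_inner \<Omega> (weak_grad \<Omega> (u j)) (weak_grad \<Omega> (u i)))"

definition block_lhs :: "real mat \<Rightarrow> real mat \<Rightarrow> real mat \<Rightarrow> real mat" where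
  "block_lhs A B C = four_block_mat A (transpose_mat B) B C"

definition block_rhs :: "real mat \<Rightarrow> real mat" where
  "block_rhs B = four_block_mat
     (0\<^sub>m (dim_col B) (dim_col B)) (0\<^sub>m (dim_col B) (dim_row B)) (- B) (0\<^sub>m (dim_row B) (dim_row B))"

text \<open>For \<open>F z = \<lambda> G z\<close> with \<open>F\<close> invertible and \<open>G\<close> possibly singular, \<open>\<lambda> = \<infinity>\<close> stands for the eigenvalue
  \<open>\<mu> = 0\<close> of \<open>G z = \<mu> F z\<close>. Eigenvalues are sought among all complex numbers.\<close>

datatype ext_eigenvalue = Finite complex | Infinite

fun geometric_mult :: "complex mat \<Rightarrow> complex mat \<Rightarrow> ext_eigenvalue \<Rightarrow> nat" where
  "geometric_mult F G (Finite l) = kernel_dim (F - l \<cdot>\<^sub>m G)"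
| "geometric_mult F G Infinite = kernel_dim G"

text \<open>The polynomial \<open>det (F - X G)\<close> in the indeterminate \<open>X\<close>.\<close>

definition pencil_poly :: "complex mat \<Rightarrow> complex mat \<Rightarrow> complex poly" where
  "pencil_poly F G = Determinant.det (mat (dim_row F) (dim_col F) (\<lambda>(i, j). [:F $$ (i, j), - (G $$ (i, j)):]))"

fun algebraic_mult :: "complex mat \<Rightarrow> complex mat \<Rightarrow> ext_eigenvalue \<Rightarrow> nat" where
  "algebraic_mult F G (Finite l) = Polynomial.order l (pencil_poly F G)"
| "algebraic_mult F G Infinite = Polynomial.order 0 (pencil_poly G F)"

text \<open>The multiset \<open>E\<close> lists the eigenvalues of \<open>F z = \<lambda> G z\<close>, each repeated according to its
  multiplicity, in the algebraic as well as in the geometric sense.\<close>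

definition gen_eigenvalues_mset ::
    "complex mat \<Rightarrow> complex mat \<Rightarrow> ext_eigenvalue multiset \<Rightarrow> bool" where
  "gen_eigenvalues_mset F G E \<longleftrightarrow>
     (\<forall>e. algebraic_mult F G e = count E e \<and> geometric_mult F G e = count E e)"

end

theory Submission
  imports
    Defs
    "Jordan_Normal_Form.Jordan_Normal_Form_Uniqueness"
    "Jordan_Normal_Form.Jordan_Normal_Form_Existence"
begin

text \<open>The matrix \<open>F\<close> is a Gram matrix: its quadratic form at the coefficients of \<open>(\<sigma>, u)\<close> is
  \<open>\<parallel>\<sigma> - \<nabla>u\<parallel>\<^sup>2 + \<parallel>div \<sigma>\<parallel>\<^sup>2\<close>. If it vanishes, then \<open>\<nabla>u = \<sigma>\<close> is divergence free, hence orthogonal to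
  \<open>\<nabla>u\<close>, so \<open>\<nabla>u = 0\<close>, and \<open>u = 0\<close> by the Friedrichs inequality. Thus \<open>F\<close> is positive definite.

  With \<open>P\<close> the projection onto the first block of coordinates, \<open>G = - (1 - P) F P\<close>. Put \<open>K = F\<^sup>-\<^sup>1 G\<close>,
  let \<open>h\<close> be the inner product of \<open>F\<close> and \<open>b(u, v) = h(P u, P v)\<close>. Then \<open>h(K u, K v) = b(u, K v)\<close>, so
  \<open>K\<close> is self-adjoint and nonnegative for the semidefinite form \<open>b\<close>; this makes \<open>K\<close> semisimple and its
  nonzero eigenvalues \<open>\<mu> = 1 / \<lambda>\<close> positive. The eigenvalue \<open>\<mu> = 0\<close> has the multiplicity
  \<open>dim ker G = m + dim ker B\<close>, and rank-nullity counts the others.\<close>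

section \<open>Kernels and ranks\<close>

lemma kernel_dim_eqI:
  assumes "A \<in> carrier_mat nr nc" "B \<in> carrier_mat nr' nc" "mat_kernel A = mat_kernel B"
  shows "kernel_dim A = kernel_dim B"
  unfolding kernel_dim_def using assms by simp

text \<open>The pencil is complex while \<open>B\<close> is real. Row operations over the reals
  remain row operations over the complex numbers, so a single Gauss-Jordan form yields both kernel
  dimensions.\<close>

lemma kernel_dim_map_mat:
  fixes A :: "real mat"
  shows "kernel_dim (map_mat complex_of_real A) = kernel_dim A"
proof -
  define nr nc where "nr = dim_row A" and "nc = dim_col A"
  have A: "A \<in> carrier_mat nr nc" unfolding nr_def nc_def by auto
  let ?h = "map_mat complex_of_real"
  define C where "C = gauss_jordan_single A"
  from gauss_jordan_single[OF A C_def[symmetric]]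
  obtain P Q where CPA: "C = P * A" and QP: "Q * P = 1\<^sub>m nr"
    and P: "P \<in> carrier_mat nr nr" and Q: "Q \<in> carrier_mat nr nr"
    and C: "C \<in> carrier_mat nr nc" and row: "row_echelon_form C" by auto
  have "?h C = ?h P * ?h A" unfolding CPA by (rule of_real_hom.mat_hom_mult[OF P A])
  moreover have "?h Q * ?h P = 1\<^sub>m nr"
    using of_real_hom.mat_hom_mult[OF Q P, symmetric] unfolding QP by (simp add: of_real_hom.mat_hom_one)
  ultimately have ker: "mat_kernel (?h C) = mat_kernel (?h A)"
    using mat_kernel_mult_eq[of "?h A" nr nc "?h P" "?h Q"] A P Q by simp
  \<comment> \<open>The echelon conditions only compare entries with 0 and 1, which the embedding
    preserves and reflects.\<close>
  have rowh: "row_echelon_form (?h C)"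
    using row C unfolding row_echelon_form_def pivot_fun_def Let_def
    by (auto simp: nr_def nc_def) (smt (verit) carrier_matD index_map_mat(1) le_antisym less_le_trans nat_less_le of_real_0 of_real_1)
  \<comment> \<open>An echelon form has kernel dimension \<open>nc\<close> minus the number of its
    nonzero rows, and these rows are the same over both fields.\<close>
  have eq: "{i. i < nr \<and> row (?h C) i \<noteq> 0\<^sub>v nc} = {i. i < nr \<and> row C i \<noteq> 0\<^sub>v nc}"
    using C by (auto simp: vec_eq_iff)
  have "kernel_dim (?h A) = kernel_dim (?h C)"
    using A C ker by (intro kernel_dim_eqI) auto
  also have "\<dots> = nc - card {i. i < nr \<and> row (?h C) i \<noteq> 0\<^sub>v nc}"
    using find_base_vectors(6)[OF rowh, of nr nc] C unfolding kernel_dim_def by simp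
  also have "\<dots> = kernel_dim C"
    using find_base_vectors(6)[OF row, of nr nc] C unfolding kernel_dim_def eq by simp
  also have "\<dots> = kernel_dim A"
    using A C mat_kernel_mult_eq[OF A P Q QP] CPA by (intro kernel_dim_eqI) auto
  finally show ?thesis .
qed

text \<open>Rank-nullity for the map \<open>v -> B v\<close>, once its image is recognised as the
  column span that defines \<open>rank\<close> and its kernel as \<open>mat_kernel\<close>.\<close>

lemma rank_plus_kernel_dim:
  fixes B :: "'a :: field mat"
  assumes B: "B \<in> carrier_mat m n"
  shows "vec_space.rank m B + kernel_dim B = n"
proof -
  interpret M: vec_space "TYPE('a)" m .
  interpret N: vec_space "TYPE('a)" n .
  have lm: "linear_map class_ring N.V M.V (\<lambda>v. B *\<^sub>v v)"
    unfolding linear_map_def mod_hom_def mod_hom_axioms_def module_hom_def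
    using B
    by (auto simp: N.vectorspace_axioms M.vectorspace_axioms N.module_axioms M.module_axioms
        mult_add_distrib_mat_vec mult_mat_vec)
  interpret L: linear_map class_ring N.V M.V "\<lambda>v. B *\<^sub>v v" by (rule lm)
  have im: "L.im = M.span (set (cols B))"
    unfolding L.im_def M.col_space_eq[OF B, unfolded M.col_space_def] using B by auto
  have ker: "L.ker = mat_kernel B" unfolding L.ker_def mat_kernel[OF B] by auto
  have "vectorspace.dim class_ring (M.vs L.im) + vectorspace.dim class_ring (N.vs L.ker) = N.dim"
    by (rule L.rank_nullity) (rule N.fin_dim)
  then show ?thesis
    using B unfolding im ker M.rank_def kernel_dim_def by (simp add: N.dim_is_n)
qed

text \<open>A pair (x, y) lies in the kernel exactly if \<open>B x = 0\<close>, with y free. To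
  count dimensions, \<open>B\<close> is replaced by the square matrix \<open>B^T B\<close>, which
  has the same kernel, so that the kernel of a block diagonal matrix with square blocks can be
  split.\<close>

lemma kernel_dim_block_rhs:
  assumes B: "B \<in> carrier_mat m n"
  shows "kernel_dim (block_rhs B) = m + kernel_dim B"
proof -
  let ?S = "transpose_mat B * B"
  let ?D = "four_block_mat ?S (0\<^sub>m n m) (0\<^sub>m m n) (0\<^sub>m m m)"
  have S: "?S \<in> carrier_mat n n" using B by auto
  have G: "block_rhs B \<in> carrier_mat (n + m) (n + m)" and D: "?D \<in> carrier_mat (n + m) (n + m)"
    using B by (auto simp: block_rhs_def)
  \<comment> \<open>Over the reals \<open>(B x) . (B x) = (B^T B x) . x\<close>, so
    \<open>B^T B x = 0\<close> forces \<open>B x = 0\<close>.\<close>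
  have kS: "?S *\<^sub>v x = 0\<^sub>v n \<longleftrightarrow> B *\<^sub>v x = 0\<^sub>v m" if x: "x \<in> carrier_vec n" for x
  proof
    assume *: "?S *\<^sub>v x = 0\<^sub>v n"
    have "scalar_prod (B *\<^sub>v x) (B *\<^sub>v x) = scalar_prod (transpose_mat B *\<^sub>v (B *\<^sub>v x)) x"
      using B x by (subst transpose_vec_mult_scalar[of _ m n]) auto
    also have "transpose_mat B *\<^sub>v (B *\<^sub>v x) = 0\<^sub>v n" using * B x by (subst (asm) assoc_mult_mat_vec) auto
    finally have "scalar_prod (B *\<^sub>v x) (B *\<^sub>v x) = 0" using x by simp
    then show "B *\<^sub>v x = 0\<^sub>v m"
      using conjugate_square_eq_0_vec[of "B *\<^sub>v x" m] B x by simp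
  next
    assume *: "B *\<^sub>v x = 0\<^sub>v m"
    show "?S *\<^sub>v x = 0\<^sub>v n" using * B x by (subst assoc_mult_mat_vec[of _ n m]) auto
  qed
  have "mat_kernel (block_rhs B) = mat_kernel ?D"
  proof -
    have "block_rhs B *\<^sub>v v = 0\<^sub>v (n + m) \<longleftrightarrow> ?D *\<^sub>v v = 0\<^sub>v (n + m)" if v: "v \<in> carrier_vec (n + m)" for v
    proof -
      define x y where "x = vec_first v n" and "y = vec_last v m"
      have xy: "v = x @\<^sub>v y" "x \<in> carrier_vec n" "y \<in> carrier_vec m"
        using v unfolding x_def y_def by auto
      have z: "0\<^sub>v (n + m) = 0\<^sub>v n @\<^sub>v 0\<^sub>v m" by (auto simp: append_vec_def)
      have 1: "block_rhs B *\<^sub>v v = 0\<^sub>v n @\<^sub>v (- B *\<^sub>v x)"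
        unfolding xy(1) block_rhs_def using B xy(2,3)
        by (subst four_block_mat_mult_vec[of _ n n _ m _ m]) auto
      have 2: "?D *\<^sub>v v = ?S *\<^sub>v x @\<^sub>v 0\<^sub>v m"
        unfolding xy(1) using B xy(2,3)
        by (subst mult_mat_vec_split[OF S]) auto
      have "- B *\<^sub>v x = 0\<^sub>v m \<longleftrightarrow> B *\<^sub>v x = 0\<^sub>v m"
        using B xy by (auto simp: vec_eq_iff)
      then show ?thesis
        unfolding 1 2 z using B xy kS[OF xy(2)]
        by (subst (1 2) append_vec_eq[of _ n]) auto
    qed
    then show ?thesis unfolding mat_kernel[OF G] mat_kernel[OF D] by blast
  qed
  then have "kernel_dim (block_rhs B) = kernel_dim ?D" by (intro kernel_dim_eqI[OF G D])
  also have "\<dots> = kernel_dim ?S + kernel_dim (0\<^sub>m m m :: real mat)"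
    using kernel_four_block_0_mat[OF refl S zero_carrier_mat, of m] B unfolding kernel_dim_def by simp
  also have "kernel_dim ?S = kernel_dim B"
    using kS by (intro kernel_dim_eqI[OF S B]) (auto simp: mat_kernel[OF S] mat_kernel[OF B])
  also have "kernel_dim (0\<^sub>m m m :: real mat) = m"
    using rank_plus_kernel_dim[of "0\<^sub>m m m :: real mat" m m] by (simp add: vec_space.rank_0I)
  finally show ?thesis by simp
qed

section \<open>Semisimple matrices and pencils\<close>

text \<open>Jordan blocks of size at most one, expressed through kernels:
  \<open>char_matrix K \<mu>\<close> is \<open>K - \<mu> I\<close>, and squaring it must not enlarge
  its kernel. Arguments with self-adjointness deliver exactly this form.\<close>

definition semisimple_eigenvalues :: "complex mat \<Rightarrow> bool" where
  "semisimple_eigenvalues K \<longleftrightarrow> (\<forall>\<mu> z. z \<in> carrier_vec (dim_col K) \<longrightarrow>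
     char_matrix K \<mu> *\<^sub>v (char_matrix K \<mu> *\<^sub>v z) = 0\<^sub>v (dim_row K) \<longrightarrow>
     char_matrix K \<mu> *\<^sub>v z = 0\<^sub>v (dim_row K))"

text \<open>The kernel of the k-th power of \<open>K - \<mu> I\<close> has as dimension the sum of
  \<open>min k\<close> over the sizes of the Jordan blocks for \<mu>. Equality for k = 1 and k = 2
  forces these sizes to be at most 1, and their sum is the algebraic multiplicity.\<close>

lemma order_char_poly_eq_kernel_dim:
  assumes K: "K \<in> carrier_mat n n" and ss: "semisimple_eigenvalues K"
  shows "Polynomial.order \<mu> (char_poly K) = kernel_dim (char_matrix K \<mu>)"
proof -
  obtain as where as: "char_poly K = (\<Prod>a\<leftarrow>as. [:- a, 1:])" using char_poly_factorized[OF K] by blast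
  obtain n_as where jnf: "jordan_nf K n_as" using jordan_nf_exists[OF K as] by blast
  let ?M = "char_matrix K \<mu>"
  have M: "?M \<in> carrier_mat n n" using K unfolding char_matrix_def by auto
  let ?ns = "map fst [(n, e)\<leftarrow>n_as . e = \<mu>]"
  have M2: "?M ^\<^sub>m 2 = ?M * ?M" using M by (simp add: numeral_2_eq_2)
  have M1: "?M ^\<^sub>m 1 = ?M" using M by simp
  have "kernel_dim (?M ^\<^sub>m 2) = kernel_dim (?M ^\<^sub>m 1)"
  proof (rule kernel_dim_eqI)
    show "?M ^\<^sub>m 2 \<in> carrier_mat n n" "?M ^\<^sub>m 1 \<in> carrier_mat n n" using M by auto
    show "mat_kernel (?M ^\<^sub>m 2) = mat_kernel (?M ^\<^sub>m 1)"
      unfolding M1 M2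
    proof (intro equalityI)
      show "mat_kernel ?M \<subseteq> mat_kernel (?M * ?M)" by (rule mat_kernel_mult_subset[OF M M])
      show "mat_kernel (?M * ?M) \<subseteq> mat_kernel ?M"
        using ss K M unfolding semisimple_eigenvalues_def mat_kernel[OF M] mat_kernel[OF mult_carrier_mat[OF M M]]
        by (auto simp: assoc_mult_mat_vec[OF M M])
    qed
  qed
  then have "(\<Sum>n\<leftarrow>?ns. min 2 n) = (\<Sum>n\<leftarrow>?ns. min 1 n)"
    using dim_gen_eigenspace[OF jnf, of \<mu>] unfolding dim_gen_eigenspace_def by metis
  \<comment> \<open>Naming the list by a variable permits induction. Since \<open>min 1\<close> lies
    termwise below \<open>min 2\<close>, equal sums force equal terms, that is, entries at most
    1.\<close>
  then have "\<forall>n\<in>set ns. min 1 n = n" if "ns = ?ns" for ns unfolding that[symmetric]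
  proof (induction ns)
    case (Cons a ns)
    have "(\<Sum>n\<leftarrow>ns. min 1 n) \<le> (\<Sum>n\<leftarrow>ns. min 2 n)" by (rule sum_list_mono) auto
    with Cons show ?case by (auto simp: min_def split: if_splits)
  qed simp
  then have "(\<Sum>n\<leftarrow>?ns. min 1 n) = sum_list ?ns"
    by (metis (no_types, lifting) map_idI)
  then have "kernel_dim ?M = sum_list ?ns"
    using dim_gen_eigenspace[OF jnf, of \<mu> 1] M1 unfolding dim_gen_eigenspace_def by simp
  also have "\<dots> = Polynomial.order \<mu> (char_poly K)"
    unfolding jordan_nf_order[OF jnf] by (simp add: case_prod_unfold)
  finally show ?thesis by simp
qed

section \<open>Pencil polynomials and the eigenvalues of
  \<open>F z = \<lambda> F K z\<close>\<close>

lemma poly_pencil_poly: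
  assumes F: "F \<in> carrier_mat n n" and G: "G \<in> carrier_mat n n"
  shows "poly (pencil_poly F G) x = Determinant.det (F - x \<cdot>\<^sub>m G)"
  unfolding pencil_poly_def
  by (rule poly_det_cong[of _ n]) (use F G in auto)

lemma poly_char_poly:
  fixes K :: "complex mat"
  assumes K: "K \<in> carrier_mat n n"
  shows "poly (char_poly K) x = Determinant.det (x \<cdot>\<^sub>m 1\<^sub>m n - K)"
  unfolding char_poly_def char_poly_matrix_def
  by (rule poly_det_cong[of _ n]) (use K in auto)

text \<open>A nonzero difference would have only finitely many roots. Leaving out the point 0
  permits division by x when pencil polynomials are compared.\<close>

lemma poly_eqI_nonzero:
  fixes p q :: "complex poly"
  assumes "\<And>x. x \<noteq> 0 \<Longrightarrow> poly p x = poly q x"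
  shows "p = q"
proof (rule ccontr)
  assume "p \<noteq> q"
  then have "finite {x. poly (p - q) x = 0}" by (intro poly_roots_finite) auto
  moreover have "- {0} \<subseteq> {x. poly (p - q) x = 0}" using assms by auto
  ultimately have "finite (- {0 :: complex})" using finite_subset by blast
  then show False using infinite_UNIV_char_0[where 'a=complex] by (simp add: Compl_eq_Diff_UNIV)
qed

text \<open>\<open>F - x F K = F (1 - x K)\<close>, and \<open>det (1 - x K)\<close> is the reversed
  characteristic polynomial of \<open>K\<close>: an eigenvalue a of \<open>K\<close> contributes the
  factor \<open>1 - a x\<close>, which is constant for a = 0.\<close>

lemma pencil_poly_mult_right:
  assumes F: "F \<in> carrier_mat n n" and K: "K \<in> carrier_mat n n"
    and cp: "char_poly K = (\<Prod>a\<leftarrow>as. [:- a, 1:])" and len: "length as = n"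
  shows "pencil_poly F (F * K) = Polynomial.smult (Determinant.det F) (\<Prod>a\<leftarrow>as. [:1, - a:])"
proof (rule poly_eqI_nonzero)
  fix x :: complex assume x: "x \<noteq> 0"
  have FK: "F * K \<in> carrier_mat n n" using F K by auto
  \<comment> \<open>Writing \<open>1 - x K\<close> as x times \<open>1/x - K\<close> brings in the
    characteristic polynomial at 1/x.\<close>
  have "F - x \<cdot>\<^sub>m (F * K) = F * (x \<cdot>\<^sub>m ((1 / x) \<cdot>\<^sub>m 1\<^sub>m n - K))"
  proof -
    have "x \<cdot>\<^sub>m ((1 / x) \<cdot>\<^sub>m 1\<^sub>m n - K) = 1\<^sub>m n - x \<cdot>\<^sub>m K"
      using K x by (intro eq_matI) (auto simp: algebra_simps)
    then show ?thesis using F K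
      by (simp add: mult_minus_distrib_mat[of _ n n _ n] mult_smult_distrib[of _ n n _ n])
  qed
  moreover have "Determinant.det ((1 / x) \<cdot>\<^sub>m 1\<^sub>m n - K) = (\<Prod>a\<leftarrow>as. 1 / x - a)"
    unfolding poly_char_poly[OF K, symmetric] cp by (simp add: poly_prod_list o_def)
  ultimately have "poly (pencil_poly F (F * K)) x
      = Determinant.det F * (x ^ n * (\<Prod>a\<leftarrow>as. 1 / x - a))"
    unfolding poly_pencil_poly[OF F FK]
    using F K by (simp only:) (subst det_mult[of _ n], auto)
  \<comment> \<open>The list \<open>as\<close> has n entries, so each factor absorbs exactly one of
    the n powers of x.\<close>
  also have "x ^ n * (\<Prod>a\<leftarrow>as. 1 / x - a) = (\<Prod>a\<leftarrow>as. 1 - x * a)"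
    unfolding len[symmetric]
  proof (induction as)
    case (Cons a as)
    have "x ^ length (a # as) * (\<Prod>a\<leftarrow>a # as. 1 / x - a)
        = (x * (1 / x - a)) * (x ^ length as * (\<Prod>a\<leftarrow>as. 1 / x - a))" by (simp add: mult_ac)
    also have "x * (1 / x - a) = 1 - x * a" using x by (simp add: field_simps)
    finally show ?case unfolding Cons.IH by simp
  qed simp
  finally show "poly (pencil_poly F (F * K)) x = poly (Polynomial.smult (Determinant.det F) (\<Prod>a\<leftarrow>as. [:1, - a:])) x"
    by (simp add: poly_prod_list o_def)
qed

text \<open>This comes from \<open>F K - x F = - F (x - K)\<close>. The order of this polynomial at
  0 is the algebraic multiplicity of \<open>Infinite\<close>.\<close>

lemma pencil_poly_mult_left:
  assumes F: "F \<in> carrier_mat n n" and K: "K \<in> carrier_mat n n"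
  shows "pencil_poly (F * K) F = Polynomial.smult ((-1) ^ n * Determinant.det F) (char_poly K)"
proof (rule poly_eqI_nonzero)
  fix x :: complex
  have FK: "F * K \<in> carrier_mat n n" using F K by auto
  have "F * K - x \<cdot>\<^sub>m F = F * (-1 \<cdot>\<^sub>m (x \<cdot>\<^sub>m 1\<^sub>m n - K))"
  proof -
    have "-1 \<cdot>\<^sub>m (x \<cdot>\<^sub>m 1\<^sub>m n - K) = K - x \<cdot>\<^sub>m 1\<^sub>m n"
      using K by (intro eq_matI) (auto simp: algebra_simps)
    then show ?thesis using F K
      by (simp add: mult_minus_distrib_mat[of _ n n _ n] mult_smult_distrib[of _ n n _ n])
  qed
  then show "poly (pencil_poly (F * K) F) x = poly (Polynomial.smult ((-1) ^ n * Determinant.det F) (char_poly K)) x"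
    unfolding poly_pencil_poly[OF FK F] using F K
    by (simp only: poly_smult poly_char_poly[OF K]) (subst det_mult[of _ n], auto)
qed

lemma order_prod_list_linear:
  fixes p :: "'a \<Rightarrow> complex poly"
  assumes "\<And>a. a \<in> set as \<Longrightarrow> p a \<noteq> 0 \<and> Polynomial.order x (p a) = (if Q a then 1 else 0)"
  shows "Polynomial.order x (\<Prod>a\<leftarrow>as. p a) = length (filter Q as)"
proof -
  \<comment> \<open>Nonvanishing is carried through the induction because orders add only over a
    nonzero product.\<close>
  have "(\<Prod>a\<leftarrow>as. p a) \<noteq> 0 \<and> Polynomial.order x (\<Prod>a\<leftarrow>as. p a) = length (filter Q as)"
    using assms
  proof (induction as)
    case Nil
    then show ?case by (auto intro: order_0I)
  next
    case (Cons a as)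
    then show ?case by (auto simp: order_mult simp del: mult_eq_0_iff)
  qed
  then show ?thesis by blast
qed

text \<open>Since \<open>F\<close> is invertible, the pencil problem amounts to
  \<open>z = \<lambda> K z\<close>, so eigenvalues of \<open>K\<close> are inverted and 0 becomes
  \<open>Infinite\<close>. Algebraic multiplicities come from the two pencil polynomials, geometric
  ones from the kernels of \<open>K - \<mu> I\<close>, and semisimplicity makes them agree.\<close>

lemma gen_eigenvalues_mset_mult:
  assumes F: "F \<in> carrier_mat n n" and K: "K \<in> carrier_mat n n"
    and detF: "Determinant.det F \<noteq> 0" and ss: "semisimple_eigenvalues K"
    and cp: "char_poly K = (\<Prod>a\<leftarrow>as. [:- a, 1:])" and len: "length as = n"
  shows "gen_eigenvalues_mset F (F * K)
     (image_mset (\<lambda>\<mu>. if \<mu> = 0 then Infinite else Finite (1 / \<mu>)) (mset as))"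
proof -
  let ?E = "image_mset (\<lambda>\<mu>. if \<mu> = 0 then Infinite else Finite (1 / \<mu>)) (mset as)"
  have FK: "F * K \<in> carrier_mat n n" using F K by auto
  have ord: "Polynomial.order \<mu> (char_poly K) = length (filter (\<lambda>a. a = \<mu>) as)" for \<mu>
    unfolding cp by (rule order_prod_list_linear) (auto simp: order_linear')
  have cntI: "count ?E Infinite = length (filter (\<lambda>a. a = 0) as)"
    by (induction as) auto
  \<comment> \<open>The test \<open>l * a = 1\<close> also covers l = 0, where no a satisfies it;
    \<open>a = 1 / l\<close> would then select a = 0, because 1 / 0 = 0.\<close>
  have cntF: "count ?E (Finite l) = length (filter (\<lambda>a. l * a = 1) as)" for l
    by (induction as) (auto simp: field_simps)
  obtain Fi where Fi: "Fi \<in> carrier_mat n n" "Fi * F = 1\<^sub>m n"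
    using det_non_zero_imp_unit[OF F detF, unfolded Units_def, of "()"] by (auto simp: ring_mat_def)
  have ker: "mat_kernel (F * X) = mat_kernel X" if "X \<in> carrier_mat n n" for X
    by (rule mat_kernel_mult_eq[OF that F Fi])
  have kK: "kernel_dim (char_matrix K \<mu>) = length (filter (\<lambda>a. a = \<mu>) as)" for \<mu>
    using order_char_poly_eq_kernel_dim[OF K ss] ord by simp
  have "algebraic_mult F (F * K) e = count ?E e \<and> geometric_mult F (F * K) e = count ?E e" for e
  proof (cases e)
    case (Finite l)
    have "algebraic_mult F (F * K) e = length (filter (\<lambda>a. l * a = 1) as)"
      unfolding Finite algebraic_mult.simps pencil_poly_mult_right[OF F K cp len] order_smult[OF detF]
    proof (rule order_prod_list_linear)
      fix a
      show "[:1, - a:] \<noteq> 0 \<and> Polynomial.order l [:1, - a:] = (if l * a = 1 then 1 else 0)"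
      proof (cases "l * a = 1")
        case True
        then have a: "a \<noteq> 0" by auto
        \<comment> \<open>If l a = 1, then \<open>1 - a X\<close> is -a times \<open>X - l\<close>,
          so l is a simple root.\<close>
        then have "[:1, - a:] = Polynomial.smult (- a) [:- l, 1:]" using True by (simp add: mult.commute)
        then show ?thesis using True a order_smult[of "- a" l "[:- l, 1:]"] order_power_n_n[of l 1] by simp
      qed (auto intro!: order_0I simp: algebra_simps)
    qed
    moreover have "geometric_mult F (F * K) e = length (filter (\<lambda>a. l * a = 1) as)"
    proof -
      have FX: "F - l \<cdot>\<^sub>m (F * K) = F * (1\<^sub>m n - l \<cdot>\<^sub>m K)"
        using F K by (simp add: mult_minus_distrib_mat[of _ n n _ n] mult_smult_distrib[of _ n n _ n])
      have "kernel_dim (F - l \<cdot>\<^sub>m (F * K)) = length (filter (\<lambda>a. l * a = 1) as)"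
      \<comment> \<open>At l = 0 the matrix is the invertible \<open>F\<close>. Otherwise
        \<open>1 - l K\<close> is -l times \<open>K - (1/l) I\<close>, and invertible left factors
        do not change the kernel.\<close>
      proof (cases "l = 0")
        case True
        have "F - l \<cdot>\<^sub>m (F * K) = F * 1\<^sub>m n"
          using F K True by (auto intro!: eq_matI)
        then have "kernel_dim (F - l \<cdot>\<^sub>m (F * K)) = kernel_dim (1\<^sub>m n :: complex mat)"
          using F ker[of "1\<^sub>m n"] by (intro kernel_dim_eqI[of _ n n _ n]) auto
        also have "\<dots> = 0" using kernel_one_mat(1)[of n] unfolding kernel_dim_def by simp
        finally show ?thesis using True by simp
      next
        case False
        have IK: "1\<^sub>m n - l \<cdot>\<^sub>m K \<in> carrier_mat n n" using K by auto
        have M: "char_matrix K (1 / l) \<in> carrier_mat n n" using K by (auto simp: char_matrix_def)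
        have eq: "1\<^sub>m n - l \<cdot>\<^sub>m K = ((- l) \<cdot>\<^sub>m 1\<^sub>m n) * char_matrix K (1 / l)"
          using K False unfolding char_matrix_def
          by (subst mult_smult_assoc_mat[of _ n n _ n]) (auto intro!: eq_matI simp: algebra_simps)
        have "((- 1 / l) \<cdot>\<^sub>m 1\<^sub>m n) * ((- l) \<cdot>\<^sub>m 1\<^sub>m n) = (1\<^sub>m n :: complex mat)"
          using False by (subst mult_smult_assoc_mat[of _ n n _ n]) (auto intro!: eq_matI)
        then have "mat_kernel (1\<^sub>m n - l \<cdot>\<^sub>m K) = mat_kernel (char_matrix K (1 / l))"
          unfolding eq by (intro mat_kernel_mult_eq[OF M]) auto
        then have "mat_kernel (F * (1\<^sub>m n - l \<cdot>\<^sub>m K)) = mat_kernel (char_matrix K (1 / l))"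
          using ker[OF IK] by (rule trans[rotated])
        then have "kernel_dim (F - l \<cdot>\<^sub>m (F * K)) = kernel_dim (char_matrix K (1 / l))"
          unfolding FX by (rule kernel_dim_eqI[OF mult_carrier_mat[OF F IK] M])
        also have "\<dots> = length (filter (\<lambda>a. a = 1 / l) as)" by (rule kK)
        also have "(\<lambda>a. a = 1 / l) = (\<lambda>a. l * a = 1)" using False by (auto simp: field_simps)
        finally show ?thesis .
      qed
      then show ?thesis unfolding Finite by simp
    qed
    ultimately show ?thesis unfolding Finite cntF by simp
  next
    case Infinite
    have "algebraic_mult F (F * K) e = length (filter (\<lambda>a. a = 0) as)"
      unfolding Infinite algebraic_mult.simps pencil_poly_mult_left[OF F K] using detF ord[of 0]
      by (subst order_smult) auto
    moreover have "kernel_dim (F * K) = kernel_dim (char_matrix K 0)"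
    proof -
      have "char_matrix K 0 = K" using K by (intro eq_matI) (auto simp: char_matrix_def)
      then show ?thesis using kernel_dim_eqI[OF FK K ker[OF K]] by simp
    qed
    ultimately show ?thesis unfolding Infinite cntI using kK[of 0] by simp
  qed
  then show ?thesis unfolding gen_eigenvalues_mset_def by blast
qed

section \<open>Pencils compressed by an orthogonal projection\<close>

text \<open>Reality lets conjugation pass through \<open>X\<close> and symmetry moves
  \<open>X\<close> to the other argument. As \<open>scalar_prod\<close> is bilinear, the Hermitian
  product carries an explicit \<open>conjugate\<close>.\<close>

lemma real_symmetric_adjoint:
  fixes X :: "complex mat"
  assumes X: "X \<in> carrier_mat n n" "transpose_mat X = X" "map_mat cnj X = X"
    and u: "u \<in> carrier_vec n" and v: "v \<in> carrier_vec n"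
  shows "scalar_prod (X *\<^sub>v u) (conjugate v) = scalar_prod u (conjugate (X *\<^sub>v v))"
proof -
  have "conjugate (X *\<^sub>v v) = X *\<^sub>v conjugate v"
  proof (rule eq_vecI)
    fix i assume i: "i < dim_vec (X *\<^sub>v conjugate v)"
    then have i': "i < n" using X by auto
    have "conjugate (X $$ (i, j)) = X $$ (i, j)" if "j < n" for j
      using arg_cong[OF X(3), of "\<lambda>Y. Y $$ (i, j)"] X(1) i' that by auto
    then show "conjugate (X *\<^sub>v v) $ i = (X *\<^sub>v conjugate v) $ i"
      using i' X(1) v by (auto simp: scalar_prod_def sum_conjugate conjugate_dist_mul intro!: sum.cong)
  qed (use X in auto)
  then show ?thesis
    using transpose_vec_mult_scalar[of X n n "conjugate v" u] X u v by simp
qed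

text \<open>\<open>F\<close> is Hermitian positive definite and \<open>P\<close> an orthogonal
  projection, both with real entries. The assumption \<open>FK\<close> says
  \<open>F K = - (1 - P) F P\<close>, the abstract form of the right-hand block matrix.\<close>

locale compressed_pencil =
  fixes N :: nat and F P K :: "complex mat"
  assumes F: "F \<in> carrier_mat N N" "transpose_mat F = F" "map_mat cnj F = F"
    and P: "P \<in> carrier_mat N N" "transpose_mat P = P" "map_mat cnj P = P" "P * P = P"
    and K: "K \<in> carrier_mat N N"
    and pos: "\<And>v. v \<in> carrier_vec N \<Longrightarrow> v \<noteq> 0\<^sub>v N \<Longrightarrow> 0 < Re (scalar_prod (F *\<^sub>v v) (conjugate v))"
    and FK: "F * K = P * F * P - F * P"
begin

section \<open>The inner product of \<open>F\<close> and its compression by \<open>P\<close>\<close>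

definition h :: "complex vec \<Rightarrow> complex vec \<Rightarrow> complex" where
  "h u v = scalar_prod (F *\<^sub>v u) (conjugate v)"

definition b :: "complex vec \<Rightarrow> complex vec \<Rightarrow> complex" where
  "b u v = h (P *\<^sub>v u) (P *\<^sub>v v)"

lemma h_cnj: "u \<in> carrier_vec N \<Longrightarrow> v \<in> carrier_vec N \<Longrightarrow> h v u = cnj (h u v)"
proof -
  assume uv: "u \<in> carrier_vec N" "v \<in> carrier_vec N"
  have "h v u = scalar_prod v (conjugate (F *\<^sub>v u))"
    unfolding h_def by (rule real_symmetric_adjoint[OF F uv(2,1)])
  also have "\<dots> = conjugate (scalar_prod (F *\<^sub>v u) (conjugate v))"
    using uv F(1) conjugate_sprod_vec[of "F *\<^sub>v u" N "conjugate v"]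
    by (simp add: comm_scalar_prod[of v N])
  finally show ?thesis unfolding h_def by simp
qed

lemma h_add: "u \<in> carrier_vec N \<Longrightarrow> v \<in> carrier_vec N \<Longrightarrow> w \<in> carrier_vec N \<Longrightarrow> h (u + v) w = h u w + h v w"
  unfolding h_def using F(1) by (simp add: mult_add_distrib_mat_vec[of _ N N] add_scalar_prod_distrib[of _ N])

lemma h_smult: "u \<in> carrier_vec N \<Longrightarrow> w \<in> carrier_vec N \<Longrightarrow> h (c \<cdot>\<^sub>v u) w = c * h u w"
  unfolding h_def using F(1) by (simp add: mult_mat_vec[of _ N N])

lemma h_zero: "w \<in> carrier_vec N \<Longrightarrow> h (0\<^sub>v N) w = 0"
proof -
  assume "w \<in> carrier_vec N"
  moreover have "0 \<cdot>\<^sub>v 0\<^sub>v N = (0\<^sub>v N :: complex Matrix.vec)" by (intro eq_vecI) auto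
  ultimately show ?thesis using h_smult[of "0\<^sub>v N" w 0] by simp
qed

lemma h_real: "u \<in> carrier_vec N \<Longrightarrow> h u u = of_real (Re (h u u))"
  using h_cnj[of u u] by (auto simp: complex_eq_iff)

lemma h_eq_0: "u \<in> carrier_vec N \<Longrightarrow> h u u = 0 \<Longrightarrow> u = 0\<^sub>v N"
  using pos[of u] unfolding h_def by fastforce

lemma h_nonneg: "u \<in> carrier_vec N \<Longrightarrow> 0 \<le> Re (h u u)"
  using pos[of u] h_zero[of u] unfolding h_def by (cases "u = 0\<^sub>v N") fastforce+

lemma Pc [simp]: "u \<in> carrier_vec N \<Longrightarrow> P *\<^sub>v u \<in> carrier_vec N"
  and Kc [simp]: "u \<in> carrier_vec N \<Longrightarrow> K *\<^sub>v u \<in> carrier_vec N"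
  and Fc [simp]: "u \<in> carrier_vec N \<Longrightarrow> F *\<^sub>v u \<in> carrier_vec N"
  using P K F by auto

lemma b_cnj: "u \<in> carrier_vec N \<Longrightarrow> v \<in> carrier_vec N \<Longrightarrow> b v u = cnj (b u v)"
  unfolding b_def by (rule h_cnj) auto

lemma b_add: "u \<in> carrier_vec N \<Longrightarrow> v \<in> carrier_vec N \<Longrightarrow> w \<in> carrier_vec N \<Longrightarrow> b (u + v) w = b u w + b v w"
  unfolding b_def using P(1) by (simp add: mult_add_distrib_mat_vec[of _ N N] h_add)

lemma b_smult: "u \<in> carrier_vec N \<Longrightarrow> w \<in> carrier_vec N \<Longrightarrow> b (c \<cdot>\<^sub>v u) w = c * b u w"
  unfolding b_def using P(1) by (simp add: mult_mat_vec[of _ N N] h_smult)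

lemma b_smult_right: "u \<in> carrier_vec N \<Longrightarrow> w \<in> carrier_vec N \<Longrightarrow> b u (c \<cdot>\<^sub>v w) = cnj c * b u w"
  using b_cnj[of "c \<cdot>\<^sub>v w" u] b_smult[of w u c] b_cnj[of w u] by simp

text \<open>The form \<open>b\<close> is degenerate: \<open>b u u = 0\<close> gives
  \<open>P u = 0\<close>, not \<open>u = 0\<close>. This still makes u orthogonal to everything with
  respect to \<open>b\<close>.\<close>

lemma b_eq_0:
  assumes "u \<in> carrier_vec N" "b u u = 0" "v \<in> carrier_vec N"
  shows "b u v = 0"
  using h_eq_0[of "P *\<^sub>v u"] assms unfolding b_def by (simp add: h_zero)

lemma F_K:
  assumes z: "z \<in> carrier_vec N"
  shows "F *\<^sub>v (K *\<^sub>v z) = P *\<^sub>v (F *\<^sub>v (P *\<^sub>v z)) - F *\<^sub>v (P *\<^sub>v z)"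
proof -
  have "F *\<^sub>v (K *\<^sub>v z) = (P * F * P - F * P) *\<^sub>v z"
    using F(1) K z by (simp flip: FK)
  also have "\<dots> = P *\<^sub>v (F *\<^sub>v (P *\<^sub>v z)) - F *\<^sub>v (P *\<^sub>v z)"
    using F(1) P(1) z
    by (subst minus_mult_distrib_mat_vec[of _ N N]) (auto simp: assoc_mult_mat_vec[of _ N N _ N])
  finally show ?thesis .
qed

text \<open>\<open>F K\<close> has its range in that of \<open>1 - P\<close>, which the idempotent
  \<open>P\<close> annihilates. Hence \<open>K z\<close> is \<open>h\<close>-orthogonal to the range
  of \<open>P\<close>.\<close>

lemma PF_K:
  assumes z: "z \<in> carrier_vec N"
  shows "P *\<^sub>v (F *\<^sub>v (K *\<^sub>v z)) = 0\<^sub>v N"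
proof -
  have "P *\<^sub>v (P *\<^sub>v v) = P *\<^sub>v v" if "v \<in> carrier_vec N" for v
    using that P(1) P(4) by (metis assoc_mult_mat_vec)
  then show ?thesis
    unfolding F_K[OF z] using P(1) z F(1)
    by (subst mult_minus_distrib_mat_vec[of _ N N]) auto
qed

text \<open>Expand \<open>F K z\<close> into \<open>P F P z - F P z\<close>. Moving the outer
  \<open>P\<close> of the first term to the other argument gives \<open>b\<close>; the second term
  vanishes by \<open>PF_K\<close>.\<close>

lemma h_K:
  assumes z: "z \<in> carrier_vec N" and z': "z' \<in> carrier_vec N"
  shows "h (K *\<^sub>v z) (K *\<^sub>v z') = b z (K *\<^sub>v z')"
proof -
  have 0: "h (P *\<^sub>v z) (K *\<^sub>v z') = 0"
  proof -
    have "h (K *\<^sub>v z') (P *\<^sub>v z) = scalar_prod (P *\<^sub>v (F *\<^sub>v (K *\<^sub>v z'))) (conjugate z)"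
      unfolding h_def using real_symmetric_adjoint[OF P(1-3), of "F *\<^sub>v (K *\<^sub>v z')" z] z z' by simp
    also have "\<dots> = 0" using PF_K[OF z'] z by simp
    finally show ?thesis using h_cnj[of "K *\<^sub>v z'" "P *\<^sub>v z"] z z' by simp
  qed
  have "h (K *\<^sub>v z) (K *\<^sub>v z')
      = scalar_prod (P *\<^sub>v (F *\<^sub>v (P *\<^sub>v z))) (conjugate (K *\<^sub>v z')) - h (P *\<^sub>v z) (K *\<^sub>v z')"
    unfolding h_def F_K[OF z] using z z' by (subst minus_scalar_prod_distrib[of _ N]) auto
  also have "\<dots> = b z (K *\<^sub>v z')"
    using 0 unfolding b_def h_def using real_symmetric_adjoint[OF P(1-3), of "F *\<^sub>v (P *\<^sub>v z)" "K *\<^sub>v z'"] z z' by simp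
  finally show ?thesis .
qed

text \<open>The left-hand side of \<open>h_K\<close> is conjugate symmetric in z and z', hence so is
  its right-hand side, which is self-adjointness.\<close>

lemma b_K: "z \<in> carrier_vec N \<Longrightarrow> z' \<in> carrier_vec N \<Longrightarrow> b (K *\<^sub>v z) z' = b z (K *\<^sub>v z')"
  using h_K[of z z'] h_K[of z' z] h_cnj[of "K *\<^sub>v z" "K *\<^sub>v z'"] b_cnj[of "K *\<^sub>v z" z'] by simp

text \<open>For an eigenvector, \<open>h_K\<close> reads
  \<open>\<mu> cnj \<mu> h(z, z) = cnj \<mu> b(z, z)\<close>. Cancelling \<open>cnj \<mu>\<close>
  exhibits \<mu> as the quotient of the nonnegative \<open>b z z\<close> by the positive
  \<open>h z z\<close>.\<close>

lemma eigenvalue_pos: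
  assumes z: "z \<in> carrier_vec N" "z \<noteq> 0\<^sub>v N" and ev: "K *\<^sub>v z = \<mu> \<cdot>\<^sub>v z" and \<mu>: "\<mu> \<noteq> 0"
  shows "\<mu> \<in> \<real>" "0 < Re \<mu>"
proof -
  have "h (K *\<^sub>v z) (K *\<^sub>v z) = \<mu> * cnj \<mu> * h z z"
    unfolding ev using z h_smult[of z "\<mu> \<cdot>\<^sub>v z" \<mu>] h_cnj[of "\<mu> \<cdot>\<^sub>v z" z] h_smult[of z z \<mu>] h_cnj[of z z]
    by simp
  moreover have "h (K *\<^sub>v z) (K *\<^sub>v z) = cnj \<mu> * b z z"
    using h_K[OF z(1) z(1)] z unfolding ev by (simp add: b_smult_right)
  ultimately have *: "\<mu> * h z z = b z z" using \<mu> by simp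
  have hz: "h z z = of_real (Re (h z z))" "0 < Re (h z z)"
    using h_real[OF z(1)] pos[OF z] unfolding h_def by auto
  have bz: "b z z = of_real (Re (b z z))" "0 \<le> Re (b z z)"
    using h_real[of "P *\<^sub>v z"] h_nonneg[of "P *\<^sub>v z"] z unfolding b_def by auto
  have "\<mu> = b z z / h z z" using * hz by (metis less_irrefl nonzero_eq_divide_eq zero_complex.simps(1))
  then have eq: "\<mu> = of_real (Re (b z z) / Re (h z z))" using hz(1) bz(1) by (metis of_real_divide)
  then show "\<mu> \<in> \<real>" by (metis Reals_of_real)
  have "Re \<mu> = Re (b z z) / Re (h z z)" using eq by (metis Re_complex_of_real)
  then have "0 \<le> Re \<mu>" using hz(2) bz(2) by simp
  moreover have "Re \<mu> \<noteq> 0" using eq \<mu> by (metis Re_complex_of_real of_real_0)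
  ultimately show "0 < Re \<mu>" by simp
qed

lemma char_matrix_mult_vec:
  assumes "v \<in> carrier_vec N"
  shows "char_matrix K \<mu> *\<^sub>v v = K *\<^sub>v v - \<mu> \<cdot>\<^sub>v v"
proof -
  have "char_matrix K \<mu> *\<^sub>v v = K *\<^sub>v v + ((- \<mu>) \<cdot>\<^sub>m 1\<^sub>m N) *\<^sub>v v"
    using assms K unfolding char_matrix_def by (subst add_mult_distrib_mat_vec[of _ N N]) auto
  also have "((- \<mu>) \<cdot>\<^sub>m 1\<^sub>m N) *\<^sub>v v = (- \<mu>) \<cdot>\<^sub>v v"
    using assms by (intro eq_vecI) auto
  finally show ?thesis using assms K by (auto intro!: eq_vecI)
qed

text \<open>If w = \<open>(K - \<mu> I) z\<close> were nonzero, it would be an eigenvector, and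
  self-adjointness for \<open>b\<close> gives \<open>b w w = 0\<close>. Degeneracy of
  \<open>b\<close> prevents an immediate conclusion, so \<open>h_K\<close> converts this into
  \<open>h w w = 0\<close>, separately for \<mu> = 0 and \<mu> nonzero.\<close>

lemma semisimple: "semisimple_eigenvalues K"
  unfolding semisimple_eigenvalues_def
proof (intro allI impI)
  fix \<mu> :: complex and z :: "complex Matrix.vec"
  assume "z \<in> carrier_vec (dim_col K)"
  then have z: "z \<in> carrier_vec N" using K by simp
  define w where "w = char_matrix K \<mu> *\<^sub>v z"
  assume "char_matrix K \<mu> *\<^sub>v (char_matrix K \<mu> *\<^sub>v z) = 0\<^sub>v (dim_row K)"
  then have 0: "char_matrix K \<mu> *\<^sub>v w = 0\<^sub>v N" using K unfolding w_def by simp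
  have w: "w \<in> carrier_vec N" unfolding w_def char_matrix_mult_vec[OF z] using z by simp
  have Kz: "K *\<^sub>v z = w + \<mu> \<cdot>\<^sub>v z"
    unfolding w_def char_matrix_mult_vec[OF z] using z K by (intro eq_vecI) auto
  have Kw: "K *\<^sub>v w = \<mu> \<cdot>\<^sub>v w"
  proof (rule eq_vecI)
    fix i assume "i < dim_vec (\<mu> \<cdot>\<^sub>v w)"
    then have "i < N" using w by simp
    then show "(K *\<^sub>v w) $ i = (\<mu> \<cdot>\<^sub>v w) $ i"
      using arg_cong[OF 0[unfolded char_matrix_mult_vec[OF w]], of "\<lambda>v. v $ i"] w K by simp
  qed (use w K in auto)
  have "w = 0\<^sub>v N"
  proof (rule ccontr)
    assume nz: "w \<noteq> 0\<^sub>v N"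
    \<comment> \<open>Reality lets the two terms with \<open>b z w\<close> cancel below, although
      one of them arises from the conjugate-linear argument.\<close>
    have real: "cnj \<mu> = \<mu>"
      using eigenvalue_pos(1)[OF w nz Kw] by (cases "\<mu> = 0") (auto simp: Reals_cnj_iff)
    have "b w w + \<mu> * b z w = b (K *\<^sub>v z) w" unfolding Kz using z w by (simp add: b_add b_smult)
    also have "\<dots> = \<mu> * b z w" unfolding b_K[OF z w] Kw using z w by (simp add: b_smult_right real)
    finally have bw: "b w w = 0" by simp
    show False
    proof (cases "\<mu> = 0")
      case True
      \<comment> \<open>For \<mu> = 0 the vector w is itself in the range of \<open>K\<close>, so
        \<open>h_K\<close> applies to it through z.\<close>
      have "K *\<^sub>v z = w" unfolding Kz using True w z by (intro eq_vecI) auto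
      then have "h w w = h (K *\<^sub>v z) (K *\<^sub>v z)" by simp
      also have "\<dots> = b w z" using h_K[OF z z] b_K[OF z z] \<open>K *\<^sub>v z = w\<close> by simp
      also have "\<dots> = 0" by (rule b_eq_0[OF w bw z])
      finally show False using h_eq_0[OF w] nz by simp
    next
      case False
      have "\<mu> * h w (\<mu> \<cdot>\<^sub>v w) = h (K *\<^sub>v w) (K *\<^sub>v w)" unfolding Kw using w by (simp add: h_smult)
      also have "\<dots> = b w (K *\<^sub>v w)" by (rule h_K[OF w w])
      also have "\<dots> = 0" unfolding Kw using w bw by (simp add: b_smult_right)
      finally have "h w (\<mu> \<cdot>\<^sub>v w) = 0" using False by simp
      then have "h (\<mu> \<cdot>\<^sub>v w) w = 0" using h_cnj[of w "\<mu> \<cdot>\<^sub>v w"] w by simp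
      then have "h w w = 0" using h_smult[OF w w] False by simp
      then show False using h_eq_0[OF w] nz by simp
    qed
  qed
  then show "char_matrix K \<mu> *\<^sub>v z = 0\<^sub>v (dim_row K)" using K unfolding w_def by simp
qed

end

text \<open>For v = a + i b with real a and b, taking the real part removes the mixed terms and
  leaves the sum of the real quadratic form at a and at b, one of which is nonzero.\<close>

lemma pos_def_complexify:
  fixes M :: "real mat"
  assumes M: "M \<in> carrier_mat N N"
    and pos: "\<And>v. v \<in> carrier_vec N \<Longrightarrow> v \<noteq> 0\<^sub>v N \<Longrightarrow> 0 < scalar_prod v (M *\<^sub>v v)"
    and v: "v \<in> carrier_vec N" "v \<noteq> 0\<^sub>v N"
  shows "0 < Re (scalar_prod (map_mat complex_of_real M *\<^sub>v v) (conjugate v))"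
proof -
  have nonneg: "0 \<le> scalar_prod x (M *\<^sub>v x)" if "x \<in> carrier_vec N" for x
    using pos[OF that] that M by (cases "x = 0\<^sub>v N") auto
  let ?a = "map_vec Re v" and ?b = "map_vec Im v"
  have ab: "?a \<in> carrier_vec N" "?b \<in> carrier_vec N" using v by auto
  have quad: "scalar_prod x (M *\<^sub>v x) = (\<Sum>i<N. \<Sum>j<N. M $$ (i, j) * (x $ j * x $ i))"
    if "x \<in> carrier_vec N" for x
    using that M by (auto simp: scalar_prod_def sum_distrib_left atLeast0LessThan mult_ac intro!: sum.cong)
  have "Re (scalar_prod (map_mat complex_of_real M *\<^sub>v v) (conjugate v))
      = (\<Sum>i<N. \<Sum>j<N. M $$ (i, j) * (Re (v $ j) * Re (v $ i) + Im (v $ j) * Im (v $ i)))"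
    using M v by (auto simp: scalar_prod_def sum_distrib_left sum_distrib_right atLeast0LessThan algebra_simps intro!: sum.cong)
  also have "\<dots> = scalar_prod ?a (M *\<^sub>v ?a) + scalar_prod ?b (M *\<^sub>v ?b)"
    unfolding quad[OF ab(1)] quad[OF ab(2)] sum.distrib[symmetric]
    by (intro sum.cong refl) (use v in \<open>auto simp: algebra_simps\<close>)
  also have "?a \<noteq> 0\<^sub>v N \<or> ?b \<noteq> 0\<^sub>v N"
    using v by (auto simp: vec_eq_iff complex_eq_iff)
  then have "0 < scalar_prod ?a (M *\<^sub>v ?a) + scalar_prod ?b (M *\<^sub>v ?b)"
    using pos ab nonneg by (meson add_nonneg_pos add_pos_nonneg)
  finally show ?thesis .
qed

section \<open>The coordinate projection and the block pencil\<close>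

definition coord_proj :: "nat \<Rightarrow> nat \<Rightarrow> complex mat" where
  "coord_proj n N = mat N N (\<lambda>(i, j). if i = j \<and> i < n then 1 else 0)"

lemma coord_proj_mult_left:
  assumes X: "X \<in> carrier_mat N N"
  shows "coord_proj n N * X = mat N N (\<lambda>(i, j). if i < n then X $$ (i, j) else 0)"
proof (rule eq_matI)
  fix i j assume ij: "i < dim_row (mat N N (\<lambda>(i, j). if i < n then X $$ (i, j) else 0))"
     "j < dim_col (mat N N (\<lambda>(i, j). if i < n then X $$ (i, j) else 0))"
  then have "(coord_proj n N * X) $$ (i, j) = (\<Sum>k<N. (if i = k \<and> i < n then 1 else 0) * X $$ (k, j))"
    using X by (simp add: coord_proj_def scalar_prod_def atLeast0LessThan)
  also have "\<dots> = (\<Sum>k<N. if k = i then (if i < n then X $$ (k, j) else 0) else 0)"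
    by (rule sum.cong) auto
  finally have "(coord_proj n N * X) $$ (i, j) = (\<Sum>k<N. if k = i then (if i < n then X $$ (k, j) else 0) else 0)" .
  then show "(coord_proj n N * X) $$ (i, j) = mat N N (\<lambda>(i, j). if i < n then X $$ (i, j) else 0) $$ (i, j)"
    using ij by simp
qed (use X in \<open>auto simp: coord_proj_def\<close>)

lemma coord_proj_mult_right:
  assumes X: "X \<in> carrier_mat N N"
  shows "X * coord_proj n N = mat N N (\<lambda>(i, j). if j < n then X $$ (i, j) else 0)"
proof (rule eq_matI)
  fix i j assume ij: "i < dim_row (mat N N (\<lambda>(i, j). if j < n then X $$ (i, j) else 0))"
     "j < dim_col (mat N N (\<lambda>(i, j). if j < n then X $$ (i, j) else 0))"
  then have "(X * coord_proj n N) $$ (i, j) = (\<Sum>k<N. X $$ (i, k) * (if k = j \<and> k < n then 1 else 0))"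
    using X by (simp add: coord_proj_def scalar_prod_def atLeast0LessThan)
  also have "\<dots> = (\<Sum>k<N. if k = j then (if j < n then X $$ (i, k) else 0) else 0)"
    by (rule sum.cong) auto
  finally have "(X * coord_proj n N) $$ (i, j) = (\<Sum>k<N. if k = j then (if j < n then X $$ (i, k) else 0) else 0)" .
  then show "(X * coord_proj n N) $$ (i, j) = mat N N (\<lambda>(i, j). if j < n then X $$ (i, j) else 0) $$ (i, j)"
    using ij by simp
qed (use X in \<open>auto simp: coord_proj_def\<close>)

text \<open>The purely algebraic core. The eigenvalues of \<open>F^-1 G\<close> are split into
  zeros, which become \<open>Infinite\<close>, and nonzero ones, whose reciprocals form the positive
  family.\<close>

theorem block_pencil_eigenvalues:
  fixes A B C :: "real mat" and F G :: "complex mat"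
  assumes A: "A \<in> carrier_mat n n" and B: "B \<in> carrier_mat m n" and C: "C \<in> carrier_mat m m"
    and sym: "transpose_mat (block_lhs A B C) = block_lhs A B C"
    and pos: "\<And>v. v \<in> carrier_vec (n + m) \<Longrightarrow> v \<noteq> 0\<^sub>v (n + m) \<Longrightarrow>
                 0 < scalar_prod v (block_lhs A B C *\<^sub>v v)"
    and F_def: "F = map_mat complex_of_real (block_lhs A B C)"
    and G_def: "G = map_mat complex_of_real (block_rhs B)"
  shows "invertible_mat F \<and>
    (\<exists>P :: real multiset. size P = vec_space.rank m B \<and> (\<forall>l\<in>#P. 0 < l) \<and>
       gen_eigenvalues_mset F G
         (replicate_mset m Infinite + replicate_mset (kernel_dim B) Infinite
          + image_mset (\<lambda>l. Finite (complex_of_real l)) P))"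
proof -
  define N where "N = n + m"
  let ?P = "coord_proj n N"
  have M: "block_lhs A B C \<in> carrier_mat N N" using A B C unfolding block_lhs_def N_def by auto
  have R: "block_rhs B \<in> carrier_mat N N" using B unfolding block_rhs_def N_def by auto
  have F: "F \<in> carrier_mat N N" and G: "G \<in> carrier_mat N N" using M R by (auto simp: F_def G_def)
  have P: "?P \<in> carrier_mat N N" by (simp add: coord_proj_def)
  have Fpos: "0 < Re (scalar_prod (F *\<^sub>v v) (conjugate v))" if "v \<in> carrier_vec N" "v \<noteq> 0\<^sub>v N" for v
    unfolding F_def by (rule pos_def_complexify[OF M _ that]) (use pos N_def in auto)
  have detF: "Determinant.det F \<noteq> 0"
  proof
    assume "Determinant.det F = 0"
    then obtain v where "v \<in> carrier_vec N" "v \<noteq> 0\<^sub>v N" "F *\<^sub>v v = 0\<^sub>v N"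
      using det_0_iff_vec_prod_zero_field[OF F] by auto
    then show False using Fpos[of v] by auto
  qed
  obtain Fi where Fi: "Fi \<in> carrier_mat N N" "Fi * F = 1\<^sub>m N" "F * Fi = 1\<^sub>m N"
    using det_non_zero_imp_unit[OF F detF, unfolded Units_def, of "()"] by (auto simp: ring_mat_def)
  have inv: "invertible_mat F"
    using F Fi unfolding invertible_mat_def inverts_mat_def by auto
  define K where "K = Fi * G"
  have K: "K \<in> carrier_mat N N" using Fi G unfolding K_def by auto
  have FKG: "F * K = G"
    unfolding K_def using Fi F G by (simp add: assoc_mult_mat[symmetric, of _ N N _ N _ N])
  \<comment> \<open>\<open>P F P\<close> keeps only the block \<open>A\<close> and
    \<open>F P\<close> keeps the first block column, so the difference leaves just \<open>-B\<close>
    in the lower left.\<close>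
  have PFP: "G = ?P * F * ?P - F * ?P"
  proof -
    have "?P * F \<in> carrier_mat N N" using P F by auto
    then show ?thesis
      unfolding coord_proj_mult_right[OF F] coord_proj_mult_right[OF \<open>?P * F \<in> carrier_mat N N\<close>]
      unfolding coord_proj_mult_left[OF F] using A B C
      by (intro eq_matI) (auto simp: F_def G_def block_lhs_def block_rhs_def N_def)
  qed
  interpret compressed_pencil N F ?P K
  proof
    have "transpose_mat F = map_mat complex_of_real (transpose_mat (block_lhs A B C))"
      unfolding F_def by (intro eq_matI) auto
    then show "transpose_mat F = F" unfolding sym F_def .
    show "map_mat cnj F = F" unfolding F_def by (intro eq_matI) auto
    show "transpose_mat ?P = ?P" "map_mat cnj ?P = ?P" unfolding coord_proj_def by (auto intro!: eq_matI)
    show "?P * ?P = ?P" unfolding coord_proj_mult_left[OF P] by (auto simp: coord_proj_def intro!: eq_matI)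
    show "F * K = ?P * F * ?P - F * ?P" unfolding FKG by (rule PFP)
  qed (fact F P K Fpos)+
  obtain as where cp: "char_poly K = (\<Prod>a\<leftarrow>as. [:- a, 1:])" and len: "length as = N"
    using char_poly_factorized[OF K] by blast
  define E where "E = image_mset (\<lambda>\<mu>. if \<mu> = 0 then Infinite else Finite (1 / \<mu>)) (mset as)"
  have gen: "gen_eigenvalues_mset F G E"
    using gen_eigenvalues_mset_mult[OF F(1) K detF semisimple cp len] unfolding FKG E_def .
  \<comment> \<open>The witness for the positive family. By \<open>real_pos\<close>, taking
    \<open>Re\<close> loses nothing.\<close>
  define Q where "Q = image_mset (\<lambda>\<mu>. 1 / Re \<mu>) (filter_mset (\<lambda>\<mu>. \<mu> \<noteq> 0) (mset as))"
  have real_pos: "\<mu> \<in> \<real> \<and> 0 < Re \<mu>" if "\<mu> \<in> set as" "\<mu> \<noteq> 0" for \<mu>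
  proof -
    have "poly (char_poly K) \<mu> = 0" unfolding cp using that(1) by (auto simp: poly_prod_list prod_list_zero_iff image_iff)
    then have "eigenvalue K \<mu>" using eigenvalue_root_char_poly[OF K] by simp
    then obtain z where "z \<in> carrier_vec N" "z \<noteq> 0\<^sub>v N" "K *\<^sub>v z = \<mu> \<cdot>\<^sub>v z"
      unfolding eigenvalue_def eigenvector_def using K by auto
    then show ?thesis using eigenvalue_pos that(2) by blast
  qed
  \<comment> \<open>The zeros are counted geometrically: \<open>gen\<close> equates their number
    with the kernel dimension of \<open>G\<close>.\<close>
  have zeros: "size (filter_mset (\<lambda>\<mu>. \<mu> = 0) (mset as)) = m + kernel_dim B"
  proof -
    have "count E Infinite = size (filter_mset (\<lambda>\<mu>. \<mu> = 0) (mset as))"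
      unfolding E_def by (induction as) auto
    moreover have "count E Infinite = kernel_dim G"
      using gen unfolding gen_eigenvalues_mset_def by (metis geometric_mult.simps(2))
    ultimately show ?thesis
      unfolding G_def kernel_dim_map_mat kernel_dim_block_rhs[OF B] by simp
  qed
  have split: "mset as = filter_mset (\<lambda>\<mu>. \<mu> = 0) (mset as) + filter_mset (\<lambda>\<mu>. \<mu> \<noteq> 0) (mset as)"
    by (rule multiset_partition)
  have "E = replicate_mset (m + kernel_dim B) Infinite + image_mset (\<lambda>l. Finite (complex_of_real l)) Q"
  proof -
    have "image_mset (\<lambda>\<mu>. if \<mu> = 0 then Infinite else Finite (1 / \<mu>)) (filter_mset (\<lambda>\<mu>. \<mu> = 0) (mset as))
        = image_mset (\<lambda>_. Infinite) (filter_mset (\<lambda>\<mu>. \<mu> = 0) (mset as))"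
      by (rule image_mset_cong) auto
    also have "\<dots> = replicate_mset (m + kernel_dim B) Infinite"
      unfolding image_mset_const_eq zeros ..
    finally have 1: "image_mset (\<lambda>\<mu>. if \<mu> = 0 then Infinite else Finite (1 / \<mu>)) (filter_mset (\<lambda>\<mu>. \<mu> = 0) (mset as))
        = replicate_mset (m + kernel_dim B) Infinite" .
    have 2: "image_mset (\<lambda>\<mu>. if \<mu> = 0 then Infinite else Finite (1 / \<mu>)) (filter_mset (\<lambda>\<mu>. \<mu> \<noteq> 0) (mset as))
        = image_mset (\<lambda>l. Finite (complex_of_real l)) Q"
      unfolding Q_def image_mset.compositionality
      by (rule image_mset_cong) (use real_pos in \<open>auto simp: o_def of_real_divide elim!: Reals_cases\<close>)
    show ?thesis unfolding E_def by (subst split) (simp only: image_mset_union 1 2)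
  qed
  also have "replicate_mset (m + kernel_dim B) Infinite
      = replicate_mset m Infinite + replicate_mset (kernel_dim B) Infinite"
    by (simp add: multiset_eq_iff)
  finally have "gen_eigenvalues_mset F G
      (replicate_mset m Infinite + replicate_mset (kernel_dim B) Infinite
          + image_mset (\<lambda>l. Finite (complex_of_real l)) Q)" using gen by simp
  moreover have "size Q = vec_space.rank m B"
  proof -
    \<comment> \<open>There are n + m eigenvalues in all; removing m + dim ker B zeros leaves n -
      dim ker B, which is the rank of B.\<close>
    have "size (filter_mset (\<lambda>\<mu>. \<mu> = 0) (mset as)) + size Q = n + m"
      using arg_cong[OF split, of size] len unfolding Q_def N_def size_union size_image_mset size_mset by linarith
    then show ?thesis using zeros rank_plus_kernel_dim[OF B] by simp
  qed
  moreover have "\<forall>l\<in>#Q. 0 < l" unfolding Q_def using real_pos by auto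
  ultimately show ?thesis using inv by blast
qed

section \<open>The $L^2$ inner product\<close>

text \<open>The squared norm, preferred to \<open>l2_norm\<close> because it expands bilinearly
  without square roots.\<close>

abbreviation l2_sq :: "'a::euclidean_space set \<Rightarrow> ('a \<Rightarrow> 'b::euclidean_space) \<Rightarrow> real" where
  "l2_sq \<Omega> f \<equiv> l2_inner \<Omega> f f"

lemma L2_measurable: "f \<in> L2 \<Omega> \<Longrightarrow> f \<in> borel_measurable (lebesgue_on \<Omega>)"
  by (simp add: L2_def)

lemma L2_sq_integrable: "f \<in> L2 \<Omega> \<Longrightarrow> integrable (lebesgue_on \<Omega>) (\<lambda>x. inner (f x) (f x))"
  by (simp add: L2_def power2_norm_eq_inner)

lemma L2I: "f \<in> borel_measurable (lebesgue_on \<Omega>) \<Longrightarrow> integrable (lebesgue_on \<Omega>) (\<lambda>x. inner (f x) (f x)) \<Longrightarrow> f \<in> L2 \<Omega>"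
  by (simp add: L2_def power2_norm_eq_inner)

text \<open>Both signs follow by expanding the squares of x + y and x - y. The bound supplies the
  integrable majorant for products of square integrable functions.\<close>

lemma inner_le_sum_sq: "\<bar>inner x y\<bar> \<le> inner x x + inner y y" for x y :: "'a::real_inner"
proof -
  have "0 \<le> inner (x + y) (x + y)" "0 \<le> inner (x - y) (x - y)" "0 \<le> inner x x" "0 \<le> inner y y"
    by (rule inner_ge_zero)+
  then show ?thesis by (simp add: inner_add inner_diff inner_commute)
qed

lemma L2_inner_integrable:
  assumes "f \<in> L2 \<Omega>" "g \<in> L2 \<Omega>"
  shows "integrable (lebesgue_on \<Omega>) (\<lambda>x. inner (f x) (g x))"
proof (rule Bochner_Integration.integrable_bound)
  show "integrable (lebesgue_on \<Omega>) (\<lambda>x. inner (f x) (f x) + inner (g x) (g x))"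
    using assms by (intro Bochner_Integration.integrable_add L2_sq_integrable)
  show "(\<lambda>x. inner (f x) (g x)) \<in> borel_measurable (lebesgue_on \<Omega>)"
    using assms by (intro borel_measurable_inner L2_measurable)
  show "AE x in lebesgue_on \<Omega>. norm (inner (f x) (g x)) \<le> norm (inner (f x) (f x) + inner (g x) (g x))"
    using inner_le_sum_sq by (auto intro!: AE_I2 order_trans[OF inner_le_sum_sq])
qed

lemma L2_zero: "(\<lambda>x. 0) \<in> L2 \<Omega>"
  by (rule L2I) auto

lemma L2_add: "f \<in> L2 \<Omega> \<Longrightarrow> g \<in> L2 \<Omega> \<Longrightarrow> (\<lambda>x. f x + g x) \<in> L2 \<Omega>"
  by (rule L2I) (auto simp: inner_add L2_inner_integrable intro!: borel_measurable_add dest: L2_measurable)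

lemma L2_scaleR: "f \<in> L2 \<Omega> \<Longrightarrow> (\<lambda>x. c *\<^sub>R f x) \<in> L2 \<Omega>"
  by (rule L2I) (auto simp: L2_inner_integrable intro!: borel_measurable_scaleR dest: L2_measurable)

lemma L2_minus: "f \<in> L2 \<Omega> \<Longrightarrow> (\<lambda>x. - f x) \<in> L2 \<Omega>"
  using L2_scaleR[of f \<Omega> "-1"] by simp

lemma L2_diff: "f \<in> L2 \<Omega> \<Longrightarrow> g \<in> L2 \<Omega> \<Longrightarrow> (\<lambda>x. f x - g x) \<in> L2 \<Omega>"
  using L2_add[of f \<Omega> "\<lambda>x. - g x"] L2_minus[of g \<Omega>] by simp

lemma L2_sum: "(\<And>i. i \<in> I \<Longrightarrow> f i \<in> L2 \<Omega>) \<Longrightarrow> (\<lambda>x. \<Sum>i\<in>I. f i x) \<in> L2 \<Omega>"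
  by (induction I rule: infinite_finite_induct) (auto intro: L2_zero L2_add)

lemma l2_inner_commute: "l2_inner \<Omega> f g = l2_inner \<Omega> g f"
  by (simp add: l2_inner_def inner_commute)

lemma l2_inner_scaleR: "l2_inner \<Omega> (\<lambda>x. c *\<^sub>R f x) h = c * l2_inner \<Omega> f h"
  by (simp add: l2_inner_def)

lemma l2_inner_scaleR_right: "l2_inner \<Omega> h (\<lambda>x. c *\<^sub>R f x) = c * l2_inner \<Omega> h f"
  by (simp add: l2_inner_def)

lemma l2_inner_minus_right: "l2_inner \<Omega> h (\<lambda>x. - f x) = - l2_inner \<Omega> h f"
  using l2_inner_scaleR_right[of \<Omega> h "-1" f] by simp

lemma l2_inner_minus_left: "l2_inner \<Omega> (\<lambda>x. - f x) h = - l2_inner \<Omega> f h"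
  using l2_inner_scaleR[of \<Omega> "-1" f h] by simp

lemma l2_inner_diff:
  "f \<in> L2 \<Omega> \<Longrightarrow> g \<in> L2 \<Omega> \<Longrightarrow> h \<in> L2 \<Omega> \<Longrightarrow> l2_inner \<Omega> (\<lambda>x. f x - g x) h = l2_inner \<Omega> f h - l2_inner \<Omega> g h"
  by (simp add: l2_inner_def inner_diff L2_inner_integrable)

lemma l2_inner_sum:
  "(\<And>i. i \<in> I \<Longrightarrow> f i \<in> L2 \<Omega>) \<Longrightarrow> h \<in> L2 \<Omega> \<Longrightarrow>
     l2_inner \<Omega> (\<lambda>x. \<Sum>i\<in>I. f i x) h = (\<Sum>i\<in>I. l2_inner \<Omega> (f i) h)"
  by (simp add: l2_inner_def inner_sum_left L2_inner_integrable)

lemma l2_inner_lincomb: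
  "(\<And>i. i \<in> I \<Longrightarrow> f i \<in> L2 \<Omega>) \<Longrightarrow> h \<in> L2 \<Omega> \<Longrightarrow>
     l2_inner \<Omega> (\<lambda>x. \<Sum>i\<in>I. c i *\<^sub>R f i x) h = (\<Sum>i\<in>I. c i * l2_inner \<Omega> (f i) h)"
  by (subst l2_inner_sum) (auto intro: L2_scaleR simp: l2_inner_scaleR)

lemma l2_sq_nonneg: "0 \<le> l2_sq \<Omega> f"
  unfolding l2_inner_def by (rule Bochner_Integration.integral_nonneg) simp

lemma l2_sq_eq_0_AE:
  assumes "f \<in> L2 \<Omega>" "l2_sq \<Omega> f = 0"
  shows "AE x in lebesgue_on \<Omega>. f x = 0"
  using integral_nonneg_eq_0_iff_AE[OF L2_sq_integrable[OF assms(1)]] assms(2)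
  by (simp add: l2_inner_def)

lemma l2_inner_cong_AE:
  assumes "f \<in> L2 \<Omega>" "g \<in> L2 \<Omega>" "h \<in> L2 \<Omega>" "AE x in lebesgue_on \<Omega>. f x = g x"
  shows "l2_inner \<Omega> f h = l2_inner \<Omega> g h"
  unfolding l2_inner_def
  using assms(4) by (intro integral_cong_AE borel_measurable_inner L2_measurable assms) auto

lemma l2_sq_diff:
  assumes "f \<in> L2 \<Omega>" "g \<in> L2 \<Omega>"
  shows "l2_sq \<Omega> (\<lambda>x. f x - g x) = l2_sq \<Omega> f - 2 * l2_inner \<Omega> g f + l2_sq \<Omega> g"
  using assms l2_inner_diff[of f \<Omega> g "\<lambda>x. f x - g x"] l2_inner_diff[of f \<Omega> g f] l2_inner_diff[of f \<Omega> g g]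
    l2_inner_commute[of \<Omega> f "\<lambda>x. f x - g x"] l2_inner_commute[of \<Omega> g "\<lambda>x. f x - g x"] l2_inner_commute[of \<Omega> g f]
  by (simp add: L2_diff)

text \<open>The parallelogram law with the square of f - g dropped; it takes the place of the
  triangle inequality for squared norms.\<close>

lemma l2_sq_add_le:
  assumes "f \<in> L2 \<Omega>" "g \<in> L2 \<Omega>"
  shows "l2_sq \<Omega> (\<lambda>x. f x + g x) \<le> 2 * l2_sq \<Omega> f + 2 * l2_sq \<Omega> g"
proof -
  have "l2_sq \<Omega> (\<lambda>x. f x - - g x) = l2_sq \<Omega> f + 2 * l2_inner \<Omega> g f + l2_sq \<Omega> g"
    unfolding l2_sq_diff[OF assms(1) L2_minus[OF assms(2)]] l2_inner_minus_left l2_inner_minus_right by simp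
  then show ?thesis
    using l2_sq_diff[OF assms] l2_sq_nonneg[of \<Omega> "\<lambda>x. f x - g x"] by simp
qed

text \<open>Induction on the number of terms with \<open>l2_sq_add_le\<close>; its factor 2 is
  harmless for a fixed finite sum. This carries approximability from basis functions to their
  combinations.\<close>

lemma l2_lincomb_tendsto:
  fixes n :: nat
  assumes "\<And>i k. i < n \<Longrightarrow> f i k \<in> L2 \<Omega>" "\<And>i. i < n \<Longrightarrow> g i \<in> L2 \<Omega>"
    and "\<And>i. i < n \<Longrightarrow> (\<lambda>k. l2_sq \<Omega> (\<lambda>x. f i k x - g i x)) \<longlonglongrightarrow> 0"
  shows "(\<lambda>k. l2_sq \<Omega> (\<lambda>x. (\<Sum>i<n. c i *\<^sub>R f i k x) - (\<Sum>i<n. c i *\<^sub>R g i x))) \<longlonglongrightarrow> 0"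
  using assms
proof (induction n)
  case 0
  then show ?case by (simp add: l2_inner_def)
next
  case (Suc n)
  let ?S = "\<lambda>k x. (\<Sum>i<n. c i *\<^sub>R f i k x) - (\<Sum>i<n. c i *\<^sub>R g i x)"
  let ?T = "\<lambda>k x. c n *\<^sub>R (f n k x - g n x)"
  have S: "?S k \<in> L2 \<Omega>" and T: "?T k \<in> L2 \<Omega>" for k
    using Suc.prems by (auto intro!: L2_diff L2_sum L2_scaleR)
  have "(\<lambda>k. l2_sq \<Omega> (?T k)) = (\<lambda>k. (c n)\<^sup>2 * l2_sq \<Omega> (\<lambda>x. f n k x - g n x))"
    by (simp only: l2_inner_scaleR l2_inner_scaleR_right) (simp add: power2_eq_square mult.assoc)
  moreover have "(\<lambda>k. (c n)\<^sup>2 * l2_sq \<Omega> (\<lambda>x. f n k x - g n x)) \<longlonglongrightarrow> 0"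
    using tendsto_mult_right_zero Suc.prems(3)[of n] by blast
  ultimately have "(\<lambda>k. 2 * l2_sq \<Omega> (?S k) + 2 * l2_sq \<Omega> (?T k)) \<longlonglongrightarrow> 2 * 0 + 2 * 0"
    using Suc.IH Suc.prems by (intro tendsto_intros) auto
  then have bound: "(\<lambda>k. 2 * l2_sq \<Omega> (?S k) + 2 * l2_sq \<Omega> (?T k)) \<longlonglongrightarrow> 0" by simp
  have "norm (l2_sq \<Omega> (\<lambda>x. ?S k x + ?T k x)) \<le> 2 * l2_sq \<Omega> (?S k) + 2 * l2_sq \<Omega> (?T k)" for k
    using l2_sq_add_le[OF S T] unfolding real_norm_def abs_of_nonneg[OF l2_sq_nonneg] .
  then have "(\<lambda>k. l2_sq \<Omega> (\<lambda>x. ?S k x + ?T k x)) \<longlonglongrightarrow> 0"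
    by (intro Lim_null_comparison[OF _ bound] always_eventually allI)
  moreover have "(\<lambda>x. ?S k x + ?T k x) = (\<lambda>x. (\<Sum>i<Suc n. c i *\<^sub>R f i k x) - (\<Sum>i<Suc n. c i *\<^sub>R g i x))" for k
    by (rule ext) (simp add: scaleR_diff_right add_diff_add)
  ultimately show ?case by (simp only:)
qed

section \<open>Test functions and the Friedrichs inequality\<close>

lemma lborel_integral_translate:
  fixes f :: "'a::euclidean_space \<Rightarrow> real"
  assumes "f \<in> borel_measurable borel"
  shows "(LINT x|lborel. f (x + c)) = (LINT x|lborel. f x)"
proof -
  have "(LINT x|lborel. f x) = (LINT x|distr lborel borel ((+) c). f x)" by (simp add: lborel_distr_plus)
  also have "\<dots> = (LINT x|lborel. f (c + x))" using assms by (subst integral_distr) auto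
  finally show ?thesis by (simp add: add.commute)
qed

lemma lborel_integrable_translate:
  fixes f :: "'a::euclidean_space \<Rightarrow> real"
  assumes "integrable lborel f"
  shows "integrable lborel (\<lambda>x. f (x + c))"
proof -
  have "integrable (distr lborel borel ((+) c)) f" using assms by (simp add: lborel_distr_plus)
  then have "integrable lborel (\<lambda>x. f (c + x))" using assms by (subst (asm) integrable_distr_eq) auto
  then show ?thesis by (simp add: add.commute)
qed

lemma continuous_compact_support_integrable:
  fixes f :: "'a::euclidean_space \<Rightarrow> real"
  assumes "continuous_on UNIV f" "compact K" "\<And>x. x \<notin> K \<Longrightarrow> f x = 0"
  shows "integrable lborel f"
proof -
  have "integrable lborel (\<lambda>x. indicator K x *\<^sub>R f x)"
    using assms by (intro borel_integrable_compact) (auto intro: continuous_on_subset)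
  also have "(\<lambda>x. indicator K x *\<^sub>R f x) = f" using assms(3) by (auto simp: indicator_def fun_eq_iff)
  finally show ?thesis .
qed

text \<open>The complement of K is open, so f coincides with 0 near x.\<close>

lemma frechet_derivative_zero_outside:
  fixes f :: "'a::euclidean_space \<Rightarrow> real"
  assumes "closed K" "\<And>x. x \<notin> K \<Longrightarrow> f x = 0" "x \<notin> K"
  shows "frechet_derivative f (at x) = (\<lambda>_. 0)"
proof -
  have "((\<lambda>_. 0) has_derivative (\<lambda>_. 0)) (at x)" by simp
  then have "(f has_derivative (\<lambda>_. 0)) (at x)"
    by (rule has_derivative_transform_within_open[of _ _ _ _ "- K"]) (use assms in auto)
  then show ?thesis using frechet_derivative_at by metis
qed

text \<open>The chain rule along a line; it makes the one-variable mean value theorem and the limit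
  of difference quotients available.\<close>

lemma has_real_derivative_along:
  fixes f :: "'a::euclidean_space \<Rightarrow> real"
  assumes "\<And>x. f differentiable (at x)"
  shows "((\<lambda>t. f (x + t *\<^sub>R b)) has_real_derivative frechet_derivative f (at (x + t *\<^sub>R b)) b) (at t)"
proof -
  let ?D = "frechet_derivative f (at (x + t *\<^sub>R b))"
  have f: "(f has_derivative ?D) (at (x + t *\<^sub>R b))" using assms frechet_derivative_works by blast
  have "((\<lambda>t. x + t *\<^sub>R b) has_derivative (\<lambda>h. h *\<^sub>R b)) (at t)"
    by (auto intro!: derivative_eq_intros)
  then have "((\<lambda>t. f (x + t *\<^sub>R b)) has_derivative (\<lambda>h. ?D (h *\<^sub>R b))) (at t)"
    using f by (rule has_derivative_compose)
  moreover have "(\<lambda>h. ?D (h *\<^sub>R b)) = (\<lambda>h. ?D b * h)"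
    using linear_frechet_derivative[OF assms] by (auto simp: linear_scale mult.commute)
  ultimately show ?thesis unfolding has_field_derivative_def by simp
qed

text \<open>The difference quotients have integral zero by translation invariance.\<close>

lemma integral_partial_derivative_eq_0:
  fixes f :: "'a::euclidean_space \<Rightarrow> real"
  assumes diff: "\<And>x. f differentiable (at x)"
    and cont: "continuous_on UNIV (\<lambda>x. frechet_derivative f (at x) b)"
    and K: "compact K" "\<And>x. x \<notin> K \<Longrightarrow> f x = 0"
  shows "(LINT x|lborel. frechet_derivative f (at x) b) = 0"
proof -
  let ?D = "\<lambda>x. frechet_derivative f (at x) b"
  have contf: "continuous_on UNIV f"
    using diff by (simp add: continuous_on_eq_continuous_within differentiable_imp_continuous_within)
  have fint: "integrable lborel f" by (rule continuous_compact_support_integrable[OF contf K])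
  have D0: "?D x = 0" if "x \<notin> K" for x
    using frechet_derivative_zero_outside[OF compact_imp_closed[OF K(1)] K(2) that] by simp
  have "bounded (?D ` K)"
    using K(1) cont by (intro compact_imp_bounded compact_continuous_image) (auto intro: continuous_on_subset)
  then obtain M where M: "\<And>x. x \<in> K \<Longrightarrow> \<bar>?D x\<bar> \<le> M" "M > 0" by (force simp: bounded_pos)
  have DM: "\<bar>?D x\<bar> \<le> M" for x using M D0[of x] by (cases "x \<in> K") auto
  obtain R where R: "\<And>x. x \<in> K \<Longrightarrow> norm x \<le> R" using K(1) compact_imp_bounded bounded_iff by metis
  \<comment> \<open>As the step sizes \<open>h k\<close> are at most 1, this one ball contains the
    supports of all difference quotients.\<close>
  define S where "S = cball (0::'a) (R + norm b)"
  define h where "h k = 1 / real (Suc k)" for k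
  have h: "0 < h k" "h k \<le> 1" for k by (auto simp: h_def)
  define q where "q k x = (f (x + h k *\<^sub>R b) - f x) / h k" for k x
  \<comment> \<open>Inside the ball the mean value theorem bounds the quotient by M; outside it,
    both evaluation points miss K.\<close>
  have q_bound: "norm (q k x) \<le> M * indicator S x" for k x
  proof (cases "x \<in> S")
    case True
    obtain t where "f (x + h k *\<^sub>R b) - f (x + 0 *\<^sub>R b) = (h k - 0) * ?D (x + t *\<^sub>R b)"
      using MVT2[of 0 "h k" "\<lambda>t. f (x + t *\<^sub>R b)" "\<lambda>t. ?D (x + t *\<^sub>R b)"] h(1)[of k]
        has_real_derivative_along[OF diff] by blast
    then have "q k x = ?D (x + t *\<^sub>R b)" using h(1)[of k] by (simp add: q_def)
    then show ?thesis using DM True by simp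
  next
    case False
    then have nx: "norm x > R + norm b" by (simp add: S_def)
    have "norm (h k *\<^sub>R b) \<le> norm b" using h[of k] by (simp add: mult_left_le_one_le)
    then have "norm (x + h k *\<^sub>R b) > R" using nx norm_triangle_ineq4[of "x + h k *\<^sub>R b" "h k *\<^sub>R b"] by simp
    then have "x + h k *\<^sub>R b \<notin> K" using R by fastforce
    moreover have "x \<notin> K" using R nx norm_ge_zero[of b] by fastforce
    ultimately show ?thesis using K(2) M(2) by (simp add: q_def)
  qed
  have qint: "(LINT x|lborel. q k x) = 0" for k
  proof -
    have "(LINT x|lborel. q k x) = ((LINT x|lborel. f (x + h k *\<^sub>R b)) - (LINT x|lborel. f x)) / h k"
      unfolding q_def using fint lborel_integrable_translate[OF fint] by simp
    then show ?thesis using lborel_integral_translate[OF borel_measurable_continuous_onI[OF contf]] by simp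
  qed
  have lim: "(\<lambda>k. q k x) \<longlonglongrightarrow> ?D x" for x
  proof -
    have "((\<lambda>t. (f (x + t *\<^sub>R b) - f (x + 0 *\<^sub>R b)) / (t - 0)) \<longlongrightarrow> ?D (x + 0 *\<^sub>R b)) (at 0)"
      using has_real_derivative_along[OF diff, of x b 0] unfolding has_field_derivative_iff .
    \<comment> \<open>The filter \<open>at 0\<close> excludes 0 itself, so the step sizes must also
      be nonzero.\<close>
    moreover have "filterlim h (at 0) sequentially"
    proof -
      have "h = (\<lambda>k. inverse (real (Suc k)))" by (auto simp: h_def fun_eq_iff inverse_eq_divide)
      then have "h \<longlonglongrightarrow> 0" using LIMSEQ_inverse_real_of_nat by simp
      moreover have "h k \<noteq> 0" for k using h(1)[of k] by simp
      ultimately show ?thesis unfolding filterlim_at by simp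
    qed
    ultimately have "(\<lambda>k. (f (x + h k *\<^sub>R b) - f (x + 0 *\<^sub>R b)) / (h k - 0)) \<longlonglongrightarrow> ?D (x + 0 *\<^sub>R b)"
      by (rule filterlim_compose)
    then show ?thesis by (simp add: q_def)
  qed
  \<comment> \<open>Dominated convergence transfers the vanishing integrals of the quotients to the
    derivative.\<close>
  have "(\<lambda>k. LINT x|lborel. q k x) \<longlonglongrightarrow> (LINT x|lborel. ?D x)"
  proof (rule integral_dominated_convergence)
    show "integrable lborel (\<lambda>x. M * indicator S x)"
      using emeasure_bounded_finite[OF bounded_cball, of 0 "R + norm b"] unfolding S_def
      by (intro integrable_mult_right integrable_real_indicator) auto
    show "?D \<in> borel_measurable lborel" using cont by (simp add: borel_measurable_continuous_onI)
    show "q k \<in> borel_measurable lborel" for k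
    proof -
      have "continuous_on UNIV (\<lambda>x. f (x + h k *\<^sub>R b))"
        by (rule continuous_on_compose2[OF contf]) (auto intro!: continuous_intros)
      then have "continuous_on UNIV (q k)"
        unfolding q_def using contf h(1)[of k] by (intro continuous_intros) auto
      then show ?thesis by (simp add: borel_measurable_continuous_onI)
    qed
    show "AE x in lborel. (\<lambda>k. q k x) \<longlonglongrightarrow> ?D x" by (intro AE_I2 lim)
    show "AE x in lborel. norm (q k x) \<le> M * indicator S x" for k by (intro AE_I2 q_bound)
  qed
  then show ?thesis unfolding qint by (simp add: LIMSEQ_const_iff)
qed

section \<open>Regularity, supports and square integrability of test functions\<close>

lemma test_functionD:
  assumes "\<phi> \<in> test_functions \<Omega>"
  shows test_function_differentiable: "\<And>x. \<phi> differentiable (at x)"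
    and test_function_partial_continuous:
      "\<And>b. b \<in> Basis \<Longrightarrow> continuous_on UNIV (\<lambda>x. frechet_derivative \<phi> (at x) b)"
    and test_function_continuous: "continuous_on UNIV \<phi>"
proof -
  have "C_k (Suc 0) \<phi>" "C_k 0 \<phi>" using assms unfolding test_functions_def by blast+
  then show "\<And>x. \<phi> differentiable (at x)"
    "\<And>b. b \<in> Basis \<Longrightarrow> continuous_on UNIV (\<lambda>x. frechet_derivative \<phi> (at x) b)"
    "continuous_on UNIV \<phi>" by auto
qed

lemma test_function_support:
  assumes "\<phi> \<in> test_functions \<Omega>"
  obtains K where "compact K" "K \<subseteq> \<Omega>" "\<And>x. x \<notin> K \<Longrightarrow> \<phi> x = 0" "\<And>x. x \<notin> K \<Longrightarrow> grad \<phi> x = 0"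
proof (rule that[of "closure {x. \<phi> x \<noteq> 0}"])
  show c: "compact (closure {x. \<phi> x \<noteq> 0})" and "closure {x. \<phi> x \<noteq> 0} \<subseteq> \<Omega>"
    using assms unfolding test_functions_def by auto
  show z: "\<phi> x = 0" if "x \<notin> closure {x. \<phi> x \<noteq> 0}" for x
    using that closure_subset[of "{x. \<phi> x \<noteq> 0}"] by blast
  show "grad \<phi> x = 0" if "x \<notin> closure {x. \<phi> x \<noteq> 0}" for x
    using frechet_derivative_zero_outside[OF closed_closure z that] by (simp add: grad_def)
qed

lemma continuous_grad: "\<phi> \<in> test_functions \<Omega> \<Longrightarrow> continuous_on UNIV (grad \<phi>)"
  unfolding grad_def by (intro continuous_intros test_function_partial_continuous)

text \<open>Vanishing off \<Omega> makes the restriction immaterial, and Borel measurability allows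
  the completed measure to be replaced by \<open>lborel\<close>.\<close>

lemma lebesgue_on_lborel_open_support:
  fixes f :: "'a::euclidean_space \<Rightarrow> real"
  assumes "open \<Omega>" "f \<in> borel_measurable borel" "\<And>x. x \<notin> \<Omega> \<Longrightarrow> f x = 0"
  shows "integrable (lebesgue_on \<Omega>) f \<longleftrightarrow> integrable lborel f"
    and "(LINT x|lebesgue_on \<Omega>. f x) = (LINT x|lborel. f x)"
proof -
  have i: "(\<lambda>x. indicator \<Omega> x *\<^sub>R f x) = f" using assms(3) by (auto simp: indicator_def fun_eq_iff)
  have s: "\<Omega> \<inter> space lebesgue \<in> sets lebesgue" using assms(1) by simp
  show "integrable (lebesgue_on \<Omega>) f \<longleftrightarrow> integrable lborel f"
    unfolding integrable_restrict_space[OF s] i using assms(2) by (simp add: integrable_completion)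
  show "(LINT x|lebesgue_on \<Omega>. f x) = (LINT x|lborel. f x)"
    unfolding integral_restrict_space[OF s] i using assms(2) by (simp add: integral_completion)
qed

lemma continuous_support_L2:
  fixes f :: "'a::euclidean_space \<Rightarrow> 'b::euclidean_space"
  assumes "open \<Omega>" "continuous_on UNIV f" "compact K" "K \<subseteq> \<Omega>" "\<And>x. x \<notin> K \<Longrightarrow> f x = 0"
  shows "f \<in> L2 \<Omega>" "l2_sq \<Omega> f = (LINT x|lborel. inner (f x) (f x))"
    "integrable lborel (\<lambda>x. inner (f x) (f x))"
proof -
  have c: "continuous_on UNIV (\<lambda>x. inner (f x) (f x))" using assms(2) by (intro continuous_intros)
  show i: "integrable lborel (\<lambda>x. inner (f x) (f x))"
    by (rule continuous_compact_support_integrable[OF c assms(3)]) (simp add: assms(5))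
  have m: "(\<lambda>x. inner (f x) (f x)) \<in> borel_measurable borel" by (rule borel_measurable_continuous_onI[OF c])
  have z: "inner (f x) (f x) = 0" if "x \<notin> \<Omega>" for x using assms(4,5) that by (metis inner_zero_left subsetD)
  show "l2_sq \<Omega> f = (LINT x|lborel. inner (f x) (f x))"
    unfolding l2_inner_def by (rule lebesgue_on_lborel_open_support(2)[OF assms(1) m z])
  show "f \<in> L2 \<Omega>"
  proof (rule L2I)
    show "f \<in> borel_measurable (lebesgue_on \<Omega>)"
      using borel_measurable_continuous_onI[OF assms(2)]
      by (intro measurable_restrict_space1) (simp add: measurable_completion)
    show "integrable (lebesgue_on \<Omega>) (\<lambda>x. inner (f x) (f x))"
      using lebesgue_on_lborel_open_support(1)[OF assms(1) m z] i by simp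
  qed
qed

lemma test_function_L2:
  assumes "open \<Omega>" "\<phi> \<in> test_functions \<Omega>"
  shows "\<phi> \<in> L2 \<Omega>" "grad \<phi> \<in> L2 \<Omega>"
proof -
  obtain K where K: "compact K" "K \<subseteq> \<Omega>" "\<And>x. x \<notin> K \<Longrightarrow> \<phi> x = 0" "\<And>x. x \<notin> K \<Longrightarrow> grad \<phi> x = 0"
    using test_function_support[OF assms(2)] by blast
  show "\<phi> \<in> L2 \<Omega>"
    by (rule continuous_support_L2(1)[OF assms(1) test_function_continuous[OF assms(2)] K(1-3)])
  show "grad \<phi> \<in> L2 \<Omega>"
    by (rule continuous_support_L2(1)[OF assms(1) continuous_grad[OF assms(2)] K(1,2,4)])
qed

section \<open>Linear combinations of test functions\<close>

lemma frechet_derivative_add: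
  assumes "f differentiable (at x)" "g differentiable (at x)"
  shows "frechet_derivative (\<lambda>x. f x + g x) (at x) = (\<lambda>h. frechet_derivative f (at x) h + frechet_derivative g (at x) h)"
  using assms by (intro frechet_derivative_at[symmetric] has_derivative_add) (auto simp: frechet_derivative_works)

lemma frechet_derivative_scale:
  fixes f :: "'a::euclidean_space \<Rightarrow> real"
  assumes "f differentiable (at x)"
  shows "frechet_derivative (\<lambda>x. c * f x) (at x) = (\<lambda>h. c * frechet_derivative f (at x) h)"
  using assms by (intro frechet_derivative_at[symmetric] has_derivative_mult_right) (auto simp: frechet_derivative_works)

lemma C_k_add: "C_k k f \<Longrightarrow> C_k k g \<Longrightarrow> C_k k (\<lambda>x. f x + g x)"
proof (induction k arbitrary: f g)
  case (Suc k)
  then show ?case by (auto simp: frechet_derivative_add)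
qed (auto intro: continuous_intros)

lemma C_k_scale: "C_k k f \<Longrightarrow> C_k k (\<lambda>x. c * f x)"
proof (induction k arbitrary: f)
  case (Suc k)
  then show ?case by (auto simp: frechet_derivative_scale)
qed (auto intro: continuous_intros)

lemma C_k_zero: "C_k k (\<lambda>x. 0)"
  by (induction k) auto

lemma test_functions_zero: "(\<lambda>x. 0) \<in> test_functions \<Omega>"
  by (simp add: test_functions_def C_k_zero)

lemma test_functions_add_scale:
  assumes "f \<in> test_functions \<Omega>" "g \<in> test_functions \<Omega>"
  shows "(\<lambda>x. f x + c * g x) \<in> test_functions \<Omega>"
proof -
  have sub: "closure {x. f x + c * g x \<noteq> 0} \<subseteq> closure {x. f x \<noteq> 0} \<union> closure {x. g x \<noteq> 0}"
    by (subst closure_Un[symmetric], rule closure_mono) auto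
  have "compact (closure {x. f x \<noteq> 0} \<union> closure {x. g x \<noteq> 0})"
    using assms unfolding test_functions_def by (intro compact_Un) auto
  \<comment> \<open>The new support is a closed subset of the compact union, hence compact.\<close>
  then have "compact ((closure {x. f x \<noteq> 0} \<union> closure {x. g x \<noteq> 0}) \<inter> closure {x. f x + c * g x \<noteq> 0})"
    by (rule compact_Int_closed) (rule closed_closure)
  then have "compact (closure {x. f x + c * g x \<noteq> 0})" unfolding Int_absorb1[OF sub] .
  moreover have "C_k k (\<lambda>x. f x + c * g x)" for k
    using assms unfolding test_functions_def by (intro C_k_add C_k_scale) auto
  moreover have "closure {x. f x + c * g x \<noteq> 0} \<subseteq> \<Omega>"
    using sub assms unfolding test_functions_def by blast
  ultimately show ?thesis unfolding test_functions_def by blast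
qed

lemma grad_add_scale:
  assumes "f \<in> test_functions \<Omega>" "g \<in> test_functions \<Omega>"
  shows "grad (\<lambda>x. f x + c * g x) x = grad f x + c *\<^sub>R grad g x"
proof -
  note d = test_function_differentiable[OF assms(1)] test_function_differentiable[OF assms(2)]
  have "(\<lambda>x. c * g x) differentiable (at x)" using d(2) by (intro differentiable_mult differentiable_const)
  then show ?thesis unfolding grad_def
    by (simp add: frechet_derivative_add[OF d(1)] frechet_derivative_scale[OF d(2)] scaleR_add_left sum.distrib scaleR_sum_right)
qed

lemma test_functions_lincomb:
  fixes n :: nat
  assumes "\<And>i. i < n \<Longrightarrow> f i \<in> test_functions \<Omega>"
  shows "(\<lambda>x. \<Sum>i<n. c i * f i x) \<in> test_functions \<Omega> \<and>
     grad (\<lambda>x. \<Sum>i<n. c i * f i x) = (\<lambda>x. \<Sum>i<n. c i *\<^sub>R grad (f i) x)"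
  using assms
proof (induction n)
  case 0
  then show ?case by (auto simp: test_functions_zero grad_def)
next
  case (Suc n)
  then have IH: "(\<lambda>x. \<Sum>i<n. c i * f i x) \<in> test_functions \<Omega>"
     "grad (\<lambda>x. \<Sum>i<n. c i * f i x) = (\<lambda>x. \<Sum>i<n. c i *\<^sub>R grad (f i) x)" by auto
  have fn: "f n \<in> test_functions \<Omega>" using Suc.prems by simp
  show ?case
    using test_functions_add_scale[OF IH(1) fn, of "c n"] grad_add_scale[OF IH(1) fn, of "c n"]
    by (auto simp: IH(2))
qed

text \<open>Apply the divergence theorem to \<open>x\<^sub>b \<phi>\<^sup>2\<close>, whose derivative in the direction \<open>b\<close> is
  \<open>\<phi>\<^sup>2 + 2 x\<^sub>b \<phi> \<partial>\<^sub>b\<phi>\<close>.\<close>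

lemma friedrichs_inequality:
  fixes \<phi> :: "'a::euclidean_space \<Rightarrow> real"
  assumes "open \<Omega>" "\<phi> \<in> test_functions \<Omega>" and R: "\<And>x. x \<in> \<Omega> \<Longrightarrow> norm x \<le> R"
  shows "l2_sq \<Omega> \<phi> \<le> 4 * R\<^sup>2 * l2_sq \<Omega> (grad \<phi>)"
proof -
  \<comment> \<open>Any single coordinate direction will do, since the partial derivative is bounded
    by the full gradient.\<close>
  obtain b :: 'a where b: "b \<in> Basis" using nonempty_Basis by blast
  obtain K where K: "compact K" "K \<subseteq> \<Omega>" "\<And>x. x \<notin> K \<Longrightarrow> \<phi> x = 0" "\<And>x. x \<notin> K \<Longrightarrow> grad \<phi> x = 0"
    using test_function_support[OF assms(2)] by blast
  note diff = test_function_differentiable[OF assms(2)]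
  note cphi = test_function_continuous[OF assms(2)]
  let ?D = "\<lambda>x. frechet_derivative \<phi> (at x) b"
  note cD = test_function_partial_continuous[OF assms(2) b]
  define f where "f x = inner x b * (\<phi> x)\<^sup>2" for x
  have df: "(f has_derivative (\<lambda>h. inner x b * (2 * \<phi> x * frechet_derivative \<phi> (at x) h) + inner h b * (\<phi> x)\<^sup>2)) (at x)" for x
  proof -
    have "(\<phi> has_derivative frechet_derivative \<phi> (at x)) (at x)" using diff frechet_derivative_works by blast
    then show ?thesis unfolding f_def by (auto intro!: derivative_eq_intros simp: algebra_simps)
  qed
  have Df: "frechet_derivative f (at x) b = (\<phi> x)\<^sup>2 + 2 * inner x b * \<phi> x * ?D x" for x
    using fun_cong[OF frechet_derivative_at[OF df[of x]], of b] b by (simp add: inner_same_Basis)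
  have cDf: "continuous_on UNIV (\<lambda>x. (\<phi> x)\<^sup>2 + 2 * inner x b * \<phi> x * ?D x)"
    using cphi cD by (intro continuous_intros)
  have zero: "(LINT x|lborel. (\<phi> x)\<^sup>2 + 2 * inner x b * \<phi> x * ?D x) = 0"
    using integral_partial_derivative_eq_0[of f b K] df K(1,3) cDf unfolding Df
    by (auto simp: f_def differentiable_def)
  have int0: "integrable lborel (\<lambda>x. (\<phi> x)\<^sup>2 + 2 * inner x b * \<phi> x * ?D x)"
    by (rule continuous_compact_support_integrable[OF cDf K(1)]) (simp add: K(3))
  note phi2 = continuous_support_L2[OF assms(1) cphi K(1-3)]
  note grad2 = continuous_support_L2[OF assms(1) continuous_grad[OF assms(2)] K(1,2,4)]
  have pw: "(\<phi> x)\<^sup>2 / 2 - 2 * R\<^sup>2 * inner (grad \<phi> x) (grad \<phi> x) \<le> (\<phi> x)\<^sup>2 + 2 * inner x b * \<phi> x * ?D x" for x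
  proof (cases "x \<in> K")
    case False
    then show ?thesis using K(3,4) by simp
  next
    case True
    have "inner (grad \<phi> x) b = ?D x" unfolding grad_def using b by (simp add: inner_sum_left inner_Basis if_distrib sum.delta cong: if_cong)
    then have "\<bar>?D x\<bar> \<le> norm (grad \<phi> x)" using Basis_le_norm[OF b, of "grad \<phi> x"] by simp
    then have "(?D x)\<^sup>2 \<le> inner (grad \<phi> x) (grad \<phi> x)"
      by (metis abs_ge_zero power2_abs power2_norm_eq_inner power_mono)
    moreover have "\<bar>inner x b\<bar> \<le> R" using Basis_le_norm[OF b, of x] R[of x] True K(2) by fastforce
    then have "(inner x b)\<^sup>2 \<le> R\<^sup>2" by (metis abs_ge_zero power2_abs power_mono)
    ultimately have "(inner x b)\<^sup>2 * (?D x)\<^sup>2 \<le> R\<^sup>2 * inner (grad \<phi> x) (grad \<phi> x)"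
      by (intro mult_mono) auto
    \<comment> \<open>Half of this square absorbs the mixed term at the cost of half of the square
      of \<phi>, which is the Young inequality needed here.\<close>
    moreover have "0 \<le> (\<phi> x + 2 * inner x b * ?D x)\<^sup>2" by simp
    then have "0 \<le> (\<phi> x)\<^sup>2 / 2 + 2 * inner x b * \<phi> x * ?D x + 2 * ((inner x b)\<^sup>2 * (?D x)\<^sup>2)"
      by (simp add: power2_eq_square algebra_simps)
    ultimately show ?thesis by simp
  qed
  \<comment> \<open>The right-hand side integrates to 0, so doubling the inequality gives the
    constant \<open>4 R^2\<close>.\<close>
  have "(LINT x|lborel. (\<phi> x)\<^sup>2 / 2 - 2 * R\<^sup>2 * inner (grad \<phi> x) (grad \<phi> x))
      \<le> (LINT x|lborel. (\<phi> x)\<^sup>2 + 2 * inner x b * \<phi> x * ?D x)"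
    using phi2(3) grad2(3) int0 pw
    by (intro integral_mono) (auto simp: power2_eq_square)
  also have "(LINT x|lborel. (\<phi> x)\<^sup>2 / 2 - 2 * R\<^sup>2 * inner (grad \<phi> x) (grad \<phi> x))
      = l2_sq \<Omega> \<phi> / 2 - 2 * R\<^sup>2 * l2_sq \<Omega> (grad \<phi>)"
    using phi2(2,3) grad2(2,3) by (simp add: power2_eq_square)
  finally show ?thesis unfolding zero by simp
qed

section \<open>The discretized problem\<close>

text \<open>The Gram expansion, with the arguments ordered as in the matrices: trial function j
  first, test function i second.\<close>

lemma l2_sq_lincomb:
  assumes "\<And>i. i \<in> I \<Longrightarrow> f i \<in> L2 \<Omega>"
  shows "l2_sq \<Omega> (\<lambda>x. \<Sum>i\<in>I. c i *\<^sub>R f i x) = (\<Sum>i\<in>I. \<Sum>j\<in>I. c i * c j * l2_inner \<Omega> (f j) (f i))"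
proof -
  let ?S = "\<lambda>x. \<Sum>i\<in>I. c i *\<^sub>R f i x"
  have S: "?S \<in> L2 \<Omega>" using assms by (intro L2_sum L2_scaleR)
  have "l2_sq \<Omega> ?S = (\<Sum>i\<in>I. c i * l2_inner \<Omega> (f i) ?S)"
    by (rule l2_inner_lincomb) (use assms S in auto)
  also have "\<dots> = (\<Sum>i\<in>I. c i * (\<Sum>j\<in>I. c j * l2_inner \<Omega> (f j) (f i)))"
  proof (intro sum.cong refl)
    fix i assume "i \<in> I"
    then show "c i * l2_inner \<Omega> (f i) ?S = c i * (\<Sum>j\<in>I. c j * l2_inner \<Omega> (f j) (f i))"
      using l2_inner_lincomb[of I f \<Omega> "f i" c] assms by (simp add: l2_inner_commute[of \<Omega> "f i" ?S])
  qed
  finally show ?thesis by (simp add: sum_distrib_left mult.assoc)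
qed

lemma l2_sq_tendsto_from_norm:
  assumes "(\<lambda>k. l2_norm \<Omega> (f k)) \<longlonglongrightarrow> 0"
  shows "(\<lambda>k. l2_sq \<Omega> (f k)) \<longlonglongrightarrow> 0"
proof -
  have "(\<lambda>k. (l2_norm \<Omega> (f k))\<^sup>2) \<longlonglongrightarrow> 0\<^sup>2" using assms by (intro tendsto_intros)
  then show ?thesis by (simp add: l2_norm_def l2_sq_nonneg)
qed

text \<open>Here \<open>\<gamma>\<close> and \<open>U\<close> are \<open>\<nabla>u\<close> and \<open>u\<close>: a field that is both weakly divergence free and
  a gradient is orthogonal to the gradients of the approximating test functions, hence to itself.\<close>

lemma div_free_gradient_eq_0:
  fixes \<Omega> :: "'a::euclidean_space set"
  assumes op: "open \<Omega>" and R: "\<And>x. x \<in> \<Omega> \<Longrightarrow> norm x \<le> R"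
    and \<gamma>: "\<gamma> \<in> L2 \<Omega>" and U: "U \<in> L2 \<Omega>" and \<Phi>: "\<And>k. \<Phi> k \<in> test_functions \<Omega>"
    and orth: "\<And>k. l2_inner \<Omega> \<gamma> (grad (\<Phi> k)) = 0"
    and limU: "(\<lambda>k. l2_sq \<Omega> (\<lambda>x. \<Phi> k x - U x)) \<longlonglongrightarrow> 0"
    and limg: "(\<lambda>k. l2_sq \<Omega> (\<lambda>x. grad (\<Phi> k) x - \<gamma> x)) \<longlonglongrightarrow> 0"
  shows "AE x in lebesgue_on \<Omega>. \<gamma> x = 0" "AE x in lebesgue_on \<Omega>. U x = 0"
proof -
  note \<Phi>L2 = test_function_L2[OF op \<Phi>]
  \<comment> \<open>Pythagoras: orthogonality removes the mixed term, so the error bounds both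
    squared norms and both vanish in the limit.\<close>
  have split: "l2_sq \<Omega> (\<lambda>x. grad (\<Phi> k) x - \<gamma> x) = l2_sq \<Omega> (grad (\<Phi> k)) + l2_sq \<Omega> \<gamma>" for k
    using l2_sq_diff[OF \<Phi>L2(2)[of k] \<gamma>] orth by simp
  have "l2_sq \<Omega> \<gamma> \<le> 0"
    by (rule LIMSEQ_le_const[OF limg]) (use split in \<open>simp add: l2_sq_nonneg\<close>)
  then have g0: "l2_sq \<Omega> \<gamma> = 0" using l2_sq_nonneg[of \<Omega> \<gamma>] by linarith
  then show "AE x in lebesgue_on \<Omega>. \<gamma> x = 0" by (rule l2_sq_eq_0_AE[OF \<gamma>])
  have limgrad: "(\<lambda>k. l2_sq \<Omega> (grad (\<Phi> k))) \<longlonglongrightarrow> 0" using limg unfolding split g0 by simp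
  \<comment> \<open>The Friedrichs inequality is available for test functions only; writing U as
    \<Phi> k minus the error \<Phi> k - U passes it on to the limit.\<close>
  have "l2_sq \<Omega> U \<le> 2 * (4 * R\<^sup>2 * l2_sq \<Omega> (grad (\<Phi> k))) + 2 * l2_sq \<Omega> (\<lambda>x. \<Phi> k x - U x)" for k
  proof -
    have "l2_sq \<Omega> (\<lambda>x. \<Phi> k x + - (\<Phi> k x - U x)) \<le> 2 * l2_sq \<Omega> (\<Phi> k) + 2 * l2_sq \<Omega> (\<lambda>x. - (\<Phi> k x - U x))"
      by (rule l2_sq_add_le[OF \<Phi>L2(1) L2_minus[OF L2_diff[OF \<Phi>L2(1) U]]])
    also have "(\<lambda>x. \<Phi> k x + - (\<Phi> k x - U x)) = U" by auto
    also have "l2_sq \<Omega> (\<lambda>x. - (\<Phi> k x - U x)) = l2_sq \<Omega> (\<lambda>x. \<Phi> k x - U x)"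
      by (simp only: l2_inner_minus_left l2_inner_minus_right minus_minus)
    finally show ?thesis using friedrichs_inequality[OF op \<Phi>[of k] R] by linarith
  qed
  moreover have "(\<lambda>k. 2 * (4 * R\<^sup>2 * l2_sq \<Omega> (grad (\<Phi> k))) + 2 * l2_sq \<Omega> (\<lambda>x. \<Phi> k x - U x))
      \<longlonglongrightarrow> 2 * (4 * R\<^sup>2 * 0) + 2 * 0"
    using limgrad limU by (intro tendsto_intros)
  ultimately have "l2_sq \<Omega> U \<le> 0" using LIMSEQ_le_const by fastforce
  then have "l2_sq \<Omega> U = 0" using l2_sq_nonneg[of \<Omega> U] by linarith
  then show "AE x in lebesgue_on \<Omega>. U x = 0" by (rule l2_sq_eq_0_AE[OF U])
qed

lemma sum_lessThan_add_split:
  fixes f :: "nat \<Rightarrow> 'b::comm_monoid_add"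
  shows "(\<Sum>i<n + m. f i) = (\<Sum>i<n. f i) + (\<Sum>i<m. f (n + i))"
  by (induction m) (simp_all add: add.assoc)

text \<open>Membership provides some weak divergence, so the \<open>SOME\<close> in
  \<open>weak_div\<close> selects a genuine one.\<close>

lemma HdivD:
  assumes "\<tau> \<in> Hdiv \<Omega>"
  shows "\<tau> \<in> L2 \<Omega>" "has_weak_div \<Omega> \<tau> (weak_div \<Omega> \<tau>)"
  using assms someI_ex[of "has_weak_div \<Omega> \<tau>"] by (auto simp: Hdiv_def weak_div_def)

text \<open>Likewise for the chosen weak gradient, with the approximation restated in squared
  norms.\<close>

lemma H10D:
  fixes v :: "'a::euclidean_space \<Rightarrow> real"
  assumes "v \<in> H10 \<Omega>"
  shows "v \<in> L2 \<Omega>" "weak_grad \<Omega> v \<in> L2 \<Omega>"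
    "\<exists>\<phi> :: nat \<Rightarrow> 'a \<Rightarrow> real. (\<forall>k. \<phi> k \<in> test_functions \<Omega>) \<and>
       (\<lambda>k. l2_sq \<Omega> (\<lambda>x. \<phi> k x - v x)) \<longlonglongrightarrow> 0 \<and>
       (\<lambda>k. l2_sq \<Omega> (\<lambda>x. grad (\<phi> k) x - weak_grad \<Omega> v x)) \<longlonglongrightarrow> 0"
proof -
  show "v \<in> L2 \<Omega>" using assms by (auto simp: H10_def H1_def)
  have "has_weak_grad \<Omega> v (weak_grad \<Omega> v)"
    using assms someI_ex[of "has_weak_grad \<Omega> v"] by (auto simp: H10_def H1_def weak_grad_def)
  then show "weak_grad \<Omega> v \<in> L2 \<Omega>" by (simp add: has_weak_grad_def)
  show "\<exists>\<phi> :: nat \<Rightarrow> 'a \<Rightarrow> real. (\<forall>k. \<phi> k \<in> test_functions \<Omega>) \<and>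
       (\<lambda>k. l2_sq \<Omega> (\<lambda>x. \<phi> k x - v x)) \<longlonglongrightarrow> 0 \<and>
       (\<lambda>k. l2_sq \<Omega> (\<lambda>x. grad (\<phi> k) x - weak_grad \<Omega> v x)) \<longlonglongrightarrow> 0"
  proof -
    obtain \<phi> :: "nat \<Rightarrow> 'a \<Rightarrow> real" where \<phi>: "\<forall>k. \<phi> k \<in> test_functions \<Omega>"
      "(\<lambda>k. l2_norm \<Omega> (\<lambda>x. \<phi> k x - v x)) \<longlonglongrightarrow> 0"
      "(\<lambda>k. l2_norm \<Omega> (\<lambda>x. grad (\<phi> k) x - weak_grad \<Omega> v x)) \<longlonglongrightarrow> 0"
      using assms unfolding H10_def by blast
    show ?thesis
      by (intro exI[of _ \<phi>] conjI \<phi>(1) l2_sq_tendsto_from_norm[OF \<phi>(2)] l2_sq_tendsto_from_norm[OF \<phi>(3)])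
  qed
qed

text \<open>This is the definiteness of the quadratic form. The field \<sigma> = \<gamma> is
  divergence free and a limit of gradients, so \<open>div_free_gradient_eq_0\<close> makes \<gamma>
  and U vanish; independence of the two bases then gives zero coefficients. The functions \<gamma>
  and U are linked through their common approximations \<Phi> k.\<close>

lemma coupled_coefficients_eq_0:
  fixes \<Omega> :: "'a::euclidean_space set" and c d :: "nat \<Rightarrow> real"
  assumes op: "open \<Omega>" and R: "\<And>x. x \<in> \<Omega> \<Longrightarrow> norm x \<le> R"
    and s: "\<And>i. i < n \<Longrightarrow> s i \<in> Hdiv \<Omega>" and u: "\<And>i. i < m \<Longrightarrow> u i \<in> H10 \<Omega>"
    and bs: "ae_basis \<Omega> \<Sigma>h n s" and bu: "ae_basis \<Omega> Uh m u"
    and eq: "AE x in lebesgue_on \<Omega>. (\<Sum>i<n. c i *\<^sub>R s i x) = (\<Sum>i<m. d i *\<^sub>R weak_grad \<Omega> (u i) x)"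
    and div0: "AE x in lebesgue_on \<Omega>. (\<Sum>i<n. c i *\<^sub>R weak_div \<Omega> (s i) x) = 0"
  shows "(\<forall>i<n. c i = 0) \<and> (\<forall>i<m. d i = 0)"
proof -
  define \<sigma> where "\<sigma> x = (\<Sum>i<n. c i *\<^sub>R s i x)" for x
  define \<delta> where "\<delta> x = (\<Sum>i<n. c i *\<^sub>R weak_div \<Omega> (s i) x)" for x
  define \<gamma> where "\<gamma> x = (\<Sum>i<m. d i *\<^sub>R weak_grad \<Omega> (u i) x)" for x
  define U where "U x = (\<Sum>i<m. d i *\<^sub>R u i x)" for x
  have wd: "weak_div \<Omega> (s i) \<in> L2 \<Omega>" if "i < n" for i using HdivD(2)[OF s[OF that]] by (simp add: has_weak_div_def)
  have \<sigma>: "\<sigma> \<in> L2 \<Omega>" unfolding \<sigma>_def by (intro L2_sum L2_scaleR HdivD(1) s) simp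
  have \<delta>: "\<delta> \<in> L2 \<Omega>" unfolding \<delta>_def by (intro L2_sum L2_scaleR wd) simp
  have \<gamma>: "\<gamma> \<in> L2 \<Omega>" unfolding \<gamma>_def by (intro L2_sum L2_scaleR H10D(2) u) simp
  have U: "U \<in> L2 \<Omega>" unfolding U_def by (intro L2_sum L2_scaleR H10D(1) u) simp
  \<comment> \<open>Bundling the three conditions lets one approximating sequence be chosen per
    basis function.\<close>
  define good where "good i \<phi> \<longleftrightarrow> (\<forall>k. \<phi> k \<in> test_functions \<Omega>) \<and>
       (\<lambda>k::nat. l2_sq \<Omega> (\<lambda>x. \<phi> k x - u i x)) \<longlonglongrightarrow> 0 \<and>
       (\<lambda>k. l2_sq \<Omega> (\<lambda>x. grad (\<phi> k) x - weak_grad \<Omega> (u i) x)) \<longlonglongrightarrow> 0" for i \<phi>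
  have "\<exists>\<phi>. good i \<phi>" if "i < m" for i using H10D(3)[OF u[OF that]] unfolding good_def .
  then obtain \<phi> where "\<And>i. i < m \<Longrightarrow> good i (\<phi> i)" by metis
  then have \<phi>: "\<And>i k. i < m \<Longrightarrow> \<phi> i k \<in> test_functions \<Omega>"
    "\<And>i. i < m \<Longrightarrow> (\<lambda>k. l2_sq \<Omega> (\<lambda>x. \<phi> i k x - u i x)) \<longlonglongrightarrow> 0"
    "\<And>i. i < m \<Longrightarrow> (\<lambda>k. l2_sq \<Omega> (\<lambda>x. grad (\<phi> i k) x - weak_grad \<Omega> (u i) x)) \<longlonglongrightarrow> 0"
    unfolding good_def by blast+
  define \<Phi> where "\<Phi> k x = (\<Sum>i<m. d i * \<phi> i k x)" for k x
  have \<Phi>: "\<Phi> k \<in> test_functions \<Omega>" "grad (\<Phi> k) = (\<lambda>x. \<Sum>i<m. d i *\<^sub>R grad (\<phi> i k) x)" for k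
    using test_functions_lincomb[of m "\<lambda>i. \<phi> i k" \<Omega> d] \<phi>(1) unfolding \<Phi>_def by auto
  note \<Phi>L2 = test_function_L2[OF op \<Phi>(1)]
  have "(\<lambda>k. l2_sq \<Omega> (\<lambda>x. (\<Sum>i<m. d i *\<^sub>R \<phi> i k x) - (\<Sum>i<m. d i *\<^sub>R u i x))) \<longlonglongrightarrow> 0"
    by (intro l2_lincomb_tendsto test_function_L2(1)[OF op] H10D(1)[OF u] \<phi>)
  then have limU: "(\<lambda>k. l2_sq \<Omega> (\<lambda>x. \<Phi> k x - U x)) \<longlonglongrightarrow> 0"
    by (simp add: \<Phi>_def[abs_def] U_def[abs_def])
  have limg: "(\<lambda>k. l2_sq \<Omega> (\<lambda>x. grad (\<Phi> k) x - \<gamma> x)) \<longlonglongrightarrow> 0"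
    unfolding \<Phi>(2) \<gamma>_def
    by (intro l2_lincomb_tendsto test_function_L2(2)[OF op] H10D(2)[OF u] \<phi>)
  \<comment> \<open>Replace \<gamma> by \<sigma>, integrate by parts against the test function
    \<Phi> k in each summand, and use that the combined divergence \<delta> vanishes almost
    everywhere.\<close>
  have orth: "l2_inner \<Omega> \<gamma> (grad (\<Phi> k)) = 0" for k
  proof -
    have "l2_inner \<Omega> \<gamma> (grad (\<Phi> k)) = l2_inner \<Omega> \<sigma> (grad (\<Phi> k))"
      using eq by (intro l2_inner_cong_AE \<gamma> \<sigma> \<Phi>L2) (auto simp: \<sigma>_def \<gamma>_def)
    also have "\<dots> = (\<Sum>i<n. c i * l2_inner \<Omega> (s i) (grad (\<Phi> k)))"
      unfolding \<sigma>_def by (rule l2_inner_lincomb) (use HdivD(1) s \<Phi>L2 in auto)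
    also have "\<dots> = (\<Sum>i<n. c i * - l2_inner \<Omega> (weak_div \<Omega> (s i)) (\<Phi> k))"
      using HdivD(2)[OF s] \<Phi>(1) unfolding has_weak_div_def by (intro sum.cong) auto
    also have "\<dots> = - l2_inner \<Omega> \<delta> (\<Phi> k)"
      unfolding \<delta>_def by (subst l2_inner_lincomb) (use wd \<Phi>L2 in \<open>auto simp: sum_negf\<close>)
    also have "l2_inner \<Omega> \<delta> (\<Phi> k) = l2_inner \<Omega> (\<lambda>x. 0) (\<Phi> k)"
      using div0 by (intro l2_inner_cong_AE \<delta> L2_zero \<Phi>L2) (auto simp: \<delta>_def)
    finally show ?thesis by (simp add: l2_inner_def)
  qed
  have zero: "AE x in lebesgue_on \<Omega>. \<gamma> x = 0" "AE x in lebesgue_on \<Omega>. U x = 0"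
    by (rule div_free_gradient_eq_0[OF op R \<gamma> U \<Phi>(1) orth limU limg], assumption)+
  have "AE x in lebesgue_on \<Omega>. (\<Sum>i<n. c i *\<^sub>R s i x) = 0"
    using zero(1) eq by eventually_elim (simp add: \<gamma>_def)
  then have "\<forall>i<n. c i = 0" using bs unfolding ae_basis_def by blast
  moreover have "\<forall>i<m. d i = 0" using zero(2) bu unfolding ae_basis_def U_def by blast
  ultimately show ?thesis by blast
qed

theorem proposition5:
  fixes \<Omega> :: "'a::euclidean_space set"
    and \<Sigma>h :: "('a \<Rightarrow> 'a) set" and Uh :: "('a \<Rightarrow> real) set"
    and n m :: nat
    and s :: "nat \<Rightarrow> 'a \<Rightarrow> 'a" and u :: "nat \<Rightarrow> 'a \<Rightarrow> real"
    and A B C :: "real mat" and F G :: "complex mat"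
  assumes "bounded_lipschitz_domain \<Omega>"
    and "function_subspace \<Sigma>h" and "\<Sigma>h \<subseteq> Hdiv \<Omega>" and "ae_basis \<Omega> \<Sigma>h n s"
    and "function_subspace Uh" and "Uh \<subseteq> H10 \<Omega>" and "ae_basis \<Omega> Uh m u"
    and "A = mat_A \<Omega> n s" and "B = mat_B \<Omega> n m s u" and "C = mat_C \<Omega> m u"
    and "F = map_mat complex_of_real (block_lhs A B C)"
    and "G = map_mat complex_of_real (block_rhs B)"
  shows "invertible_mat F \<and>
    (\<exists>P :: real multiset. size P = vec_space.rank m B \<and> (\<forall>l\<in>#P. 0 < l) \<and>
       gen_eigenvalues_mset F G
         (replicate_mset m Infinite + replicate_mset (kernel_dim B) Infinite
          + image_mset (\<lambda>l. Finite (complex_of_real l)) P))"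
proof -
  have op: "open \<Omega>" and "bounded \<Omega>" using assms(1) by (auto simp: bounded_lipschitz_domain_def)
  then obtain R where R: "\<And>x. x \<in> \<Omega> \<Longrightarrow> norm x \<le> R" using bounded_iff by metis
  have s: "s i \<in> Hdiv \<Omega>" if "i < n" for i using assms(3,4) that by (auto simp: ae_basis_def)
  have u: "u i \<in> H10 \<Omega>" if "i < m" for i using assms(6,7) that by (auto simp: ae_basis_def)
  have wd: "weak_div \<Omega> (s i) \<in> L2 \<Omega>" if "i < n" for i using HdivD(2)[OF s[OF that]] by (simp add: has_weak_div_def)
  have A: "A \<in> carrier_mat n n" and B: "B \<in> carrier_mat m n" and C: "C \<in> carrier_mat m m"
    by (auto simp: assms mat_A_def mat_B_def mat_C_def)
  let ?M = "block_lhs A B C"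
  have M: "?M \<in> carrier_mat (n + m) (n + m)" using A B C by (auto simp: block_lhs_def)
  \<comment> \<open>The Gram vectors: coordinate i of the block system corresponds to the pair (p i,
    q i). The minus sign reproduces the sign in \<open>mat_B\<close> and cancels in
    \<open>mat_C\<close>; the index i - n restarts the count in the second block.\<close>
  define p where "p i = (if i < n then s i else (\<lambda>x. - weak_grad \<Omega> (u (i - n)) x))" for i
  define q where "q i = (if i < n then weak_div \<Omega> (s i) else (\<lambda>x. 0))" for i
  have p: "p i \<in> L2 \<Omega>" and q: "q i \<in> L2 \<Omega>" if "i < n + m" for i
    using that HdivD(1)[OF s] H10D(2)[OF u] wd by (auto simp: p_def q_def L2_zero intro!: L2_minus)
  have entry: "?M $$ (i, j) = l2_inner \<Omega> (p j) (p i) + l2_inner \<Omega> (q j) (q i)"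
    if "i < n + m" "j < n + m" for i j
  proof -
    have z: "l2_inner \<Omega> (\<lambda>x. 0) f = 0" "l2_inner \<Omega> f (\<lambda>x. 0) = 0" for f :: "'a \<Rightarrow> real"
      by (simp_all add: l2_inner_def)
    show ?thesis using that A B C
      by (auto simp: block_lhs_def p_def q_def z l2_inner_minus_left l2_inner_minus_right
          l2_inner_commute[of \<Omega> "weak_grad \<Omega> (u (j - n))" "s i"] assms(8-10) mat_A_def mat_B_def mat_C_def)
  qed
  have sym: "transpose_mat ?M = ?M"
  proof (rule eq_matI)
    fix i j assume "i < dim_row ?M" "j < dim_col ?M"
    then have "i < n + m" "j < n + m" using M by auto
    then show "transpose_mat ?M $$ (i, j) = ?M $$ (i, j)"
      using M entry[of i j] entry[of j i] l2_inner_commute[of \<Omega> "p j" "p i"] l2_inner_commute[of \<Omega> "q j" "q i"]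
      by simp
  qed (use M in auto)
  have pos: "0 < scalar_prod v (?M *\<^sub>v v)" if v: "v \<in> carrier_vec (n + m)" "v \<noteq> 0\<^sub>v (n + m)" for v
  proof -
    \<comment> \<open>For coefficients of \<sigma> and u these are \<open>\<sigma> - grad u\<close>
      and \<open>div \<sigma>\<close>.\<close>
    let ?p = "\<lambda>x. \<Sum>i<n + m. vec_index v i *\<^sub>R p i x" and ?q = "\<lambda>x. \<Sum>i<n + m. vec_index v i *\<^sub>R q i x"
    have pq: "?p \<in> L2 \<Omega>" "?q \<in> L2 \<Omega>" by (intro L2_sum L2_scaleR p q; simp)+
    have "scalar_prod v (?M *\<^sub>v v)
        = (\<Sum>i<n + m. \<Sum>j<n + m. vec_index v i * vec_index v j * (l2_inner \<Omega> (p j) (p i) + l2_inner \<Omega> (q j) (q i)))"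
      using v(1) M by (auto simp: scalar_prod_def entry sum_distrib_left atLeast0LessThan mult_ac intro!: sum.cong)
    also have "\<dots> = l2_sq \<Omega> ?p + l2_sq \<Omega> ?q"
      by (subst (1 2) l2_sq_lincomb) (use p q in \<open>auto simp: distrib_left sum.distrib\<close>)
    finally have quad: "scalar_prod v (?M *\<^sub>v v) = l2_sq \<Omega> ?p + l2_sq \<Omega> ?q" .
    have "l2_sq \<Omega> ?p \<noteq> 0 \<or> l2_sq \<Omega> ?q \<noteq> 0"
    proof (rule ccontr)
      assume "\<not> ?thesis"
      then have "AE x in lebesgue_on \<Omega>. ?p x = 0" "AE x in lebesgue_on \<Omega>. ?q x = 0"
        using l2_sq_eq_0_AE pq by blast+
      \<comment> \<open>Splitting the sums at n turns the vanishing of both combinations into the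
        hypotheses of \<open>coupled_coefficients_eq_0\<close>.\<close>
      then have ae: "AE x in lebesgue_on \<Omega>. (\<Sum>i<n. vec_index v i *\<^sub>R s i x) = (\<Sum>i<m. vec_index v (n + i) *\<^sub>R weak_grad \<Omega> (u i) x)"
        "AE x in lebesgue_on \<Omega>. (\<Sum>i<n. vec_index v i *\<^sub>R weak_div \<Omega> (s i) x) = 0"
        by (auto simp: sum_lessThan_add_split p_def q_def sum_negf)
      have z: "(\<forall>i<n. vec_index v i = 0) \<and> (\<forall>i<m. vec_index v (n + i) = 0)"
        by (rule coupled_coefficients_eq_0[OF op R s u assms(4,7) ae])
      have "vec_index v i = 0" if "i < n + m" for i
        using that z[THEN conjunct1, rule_format, of i] z[THEN conjunct2, rule_format, of "i - n"]
        by (cases "i < n") simp_all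
      then show False using v by (auto simp: vec_eq_iff)
    qed
    then show ?thesis using l2_sq_nonneg[of \<Omega> ?p] l2_sq_nonneg[of \<Omega> ?q] unfolding quad by linarith
  qed
  show ?thesis by (rule block_pencil_eigenvalues[OF A B C sym pos assms(11,12)])
qed

end
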